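(* Let $E=E(0,\infty)$ be a symmetric Banach space on the semi-axis $(0,\infty)$. For every given $0\le x\in E$, there exists a symmetric linear functional $\varphi:E\to\mathbb{R}$ such that $$\varphi(x)=\lim_{m\to\infty}\frac1m\|\sigma_m(\mu(x))\|_E.$$
   Context: For a measurable function $x$ on $(0,\infty)$, $\mu(t,x)=\inf\{s\ge0:\ |\{|x|>s\}|\le t\}$ (Lebesgue measure) is its decreasing rearrangement. A symmetric Banach space $E$ on $(0,\infty)$ is a Banach space of (real-valued) functions $E\subset(L_1+L_\infty)(0,\infty)$ such that: (a) $x\in E$, $y\in L_1+L_\infty$, $\mu(y)=\mu(x)$ imply $y\in E$ and $\|y\|_E=\|x\|_E$; (b) $0\le y\le x\in E$ implies $y\in E$ and $\|y\|_E\le\|x\|_E$. The dilation operator is $(\sigma_mx)(t)=x(t/m)$, $t>0$. A linear functional $\varphi$ on $E$ is symmetric if $\varphi(y)=\varphi(x)$ for all $0\le x,y\in E$ with $\mu(y)=\mu(x)$. *)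

theory Defs
  imports "HOL-Analysis.Analysis"
begin

(* Functions on (0,oo) are represented by total functions on the reals whose values
   outside (0,oo) are never inspected; they are not quotiented by a.e. equality, so
   pointwise relations between functions are read as holding a.e. *)

abbreviation half_line :: "real measure" where
  "half_line \<equiv> lebesgue_on {0<..}"

definition L1_plus_Linf :: "(real \<Rightarrow> real) set" where
  "L1_plus_Linf = {x. \<exists>g h. integrable half_line g \<and>
      h \<in> borel_measurable half_line \<and> (\<exists>C. AE t in half_line. \<bar>h t\<bar> \<le> C) \<and>
      (\<forall>t>0. x t = g t + h t)}"

(* Only meaningful for t > 0 and x in L1 + Linf: otherwise the set below may be empty,
   and the real-valued Inf is then unspecified. *)
definition decr_rearr :: "(real \<Rightarrow> real) \<Rightarrow> real \<Rightarrow> real" where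
  "decr_rearr x t =
     Inf {s. 0 \<le> s \<and> emeasure half_line {u \<in> {0<..}. s < \<bar>x u\<bar>} \<le> ennreal t}"

definition equimeasurable :: "(real \<Rightarrow> real) \<Rightarrow> (real \<Rightarrow> real) \<Rightarrow> bool" where
  "equimeasurable x y \<longleftrightarrow> (\<forall>t>0. decr_rearr x t = decr_rearr y t)"

definition dilation :: "real \<Rightarrow> (real \<Rightarrow> real) \<Rightarrow> real \<Rightarrow> real" where
  "dilation m x t = x (t / m)"

(* The norm nrm is only constrained on E. By rearrangement, E and nrm are invariant
   under changing functions on null sets. *)
locale symmetric_banach_space =
  fixes E :: "(real \<Rightarrow> real) set" and nrm :: "(real \<Rightarrow> real) \<Rightarrow> real"
  assumes subset: "E \<subseteq> L1_plus_Linf"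
    and zero_mem: "(\<lambda>t. 0) \<in> E"
    and add_mem: "x \<in> E \<Longrightarrow> y \<in> E \<Longrightarrow> (\<lambda>t. x t + y t) \<in> E"
    and scale_mem: "x \<in> E \<Longrightarrow> (\<lambda>t. c * x t) \<in> E"
    and nrm_nonneg: "x \<in> E \<Longrightarrow> 0 \<le> nrm x"
    and nrm_eq_0_iff: "x \<in> E \<Longrightarrow> nrm x = 0 \<longleftrightarrow> (AE t in half_line. x t = 0)"
    and nrm_scale: "x \<in> E \<Longrightarrow> nrm (\<lambda>t. c * x t) = \<bar>c\<bar> * nrm x"
    and nrm_triangle: "x \<in> E \<Longrightarrow> y \<in> E \<Longrightarrow> nrm (\<lambda>t. x t + y t) \<le> nrm x + nrm y"
    and complete: "(\<And>n. X n \<in> E) \<Longrightarrow>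
      (\<And>e. 0 < e \<Longrightarrow> \<exists>M. \<forall>m\<ge>M. \<forall>n\<ge>M. nrm (\<lambda>t. X m t - X n t) < e) \<Longrightarrow>
      \<exists>x\<in>E. (\<lambda>n. nrm (\<lambda>t. X n t - x t)) \<longlonglongrightarrow> 0"
    and rearrangement: "x \<in> E \<Longrightarrow> y \<in> L1_plus_Linf \<Longrightarrow> equimeasurable y x \<Longrightarrow>
      y \<in> E \<and> nrm y = nrm x"
    and solid: "x \<in> E \<Longrightarrow> y \<in> borel_measurable half_line \<Longrightarrow>
      (AE t in half_line. 0 \<le> y t \<and> y t \<le> x t) \<Longrightarrow> y \<in> E \<and> nrm y \<le> nrm x"

(* Compatibility with a.e. equality makes the functional one on classes of functions;
   no positivity or continuity is required. *)
definition linear_functional_on ::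
    "(real \<Rightarrow> real) set \<Rightarrow> ((real \<Rightarrow> real) \<Rightarrow> real) \<Rightarrow> bool" where
  "linear_functional_on E \<phi> \<longleftrightarrow>
     (\<forall>x\<in>E. \<forall>y\<in>E. (AE t in half_line. x t = y t) \<longrightarrow> \<phi> x = \<phi> y) \<and>
     (\<forall>x\<in>E. \<forall>y\<in>E. \<phi> (\<lambda>t. x t + y t) = \<phi> x + \<phi> y) \<and>
     (\<forall>x\<in>E. \<forall>c. \<phi> (\<lambda>t. c * x t) = c * \<phi> x)"

definition symmetric_functional_on ::
    "(real \<Rightarrow> real) set \<Rightarrow> ((real \<Rightarrow> real) \<Rightarrow> real) \<Rightarrow> bool" where
  "symmetric_functional_on E \<phi> \<longleftrightarrow>
     (\<forall>x\<in>E. \<forall>y\<in>E. (AE t in half_line. 0 \<le> x t) \<longrightarrow> (AE t in half_line. 0 \<le> y t) \<longrightarrow>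
        equimeasurable y x \<longrightarrow> \<phi> y = \<phi> x)"

end

theory Submission
  imports Defs "HOL-Library.Function_Algebras"
begin

text \<open>Write \<open>x\<^sup>*\<close> for the decreasing rearrangement of \<open>x\<close>, and \<open>\<sigma>(m)\<close> for dilation by \<open>m\<close>.  The numbers
\<open>a\<^sub>m = \<parallel>\<sigma>(m) x\<^sup>*\<parallel>\<close> increase, and \<open>\<sigma>(k m) x\<^sup>*\<close> is distributed as \<open>k\<close> disjoint copies of
\<open>\<sigma>(m) x\<^sup>*\<close>, so \<open>a\<^sub>k\<^sub>m \<le> k a\<^sub>m\<close>; hence \<open>a\<^sub>m / m\<close> converges to a limit \<open>c\<close>.

A linear functional is symmetric exactly when it kills every difference \<open>u - v\<close> of
nonnegative equimeasurable elements of \<open>E\<close>.  Prescribing the value of such a functional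
at \<open>x\<close> is therefore pure linear algebra as soon as \<open>x\<close> is outside the linear span of these
differences.  If \<open>c = 0\<close> the zero functional works, so everything rests
on the claim that \<open>c = 0\<close> whenever \<open>x\<close>, equivalently \<open>g = x\<^sup>*\<close>, belongs to that span.

Suppose \<open>g = \<Sum>(u\<^sub>i - v\<^sub>i)\<close> with \<open>n\<close> summands, \<open>u\<^sub>i\<close> and \<open>v\<^sub>i\<close> equimeasurable.
Integrating over \<open>(0,b)\<close> enlarged by the sets on which the \<open>v\<^sub>i\<close> are large, the large parts
of \<open>u\<^sub>i\<close> and \<open>v\<^sub>i\<close> cancel and only \<open>\<integral>\<^sub>0\<^sup>b g \<le> b f(b)\<close> survives, where
\<open>f = (n + 1) \<Sum> u\<^sub>i\<^sup>*\<close> is a decreasing element of \<open>E\<close>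
(\<open>integral_bound_of_rearrangement_differences\<close>).

Such a bound says that \<open>f\<close> dominates a sum of many averaged dilations of \<open>g\<close>: up to a
constant, \<open>f \<ge> \<Sum>\<^sub>k\<^sub>\<le>\<^sub>N 2\<^sup>-\<^sup>k \<sigma>(2\<^sup>k) g\<close>.  Each summand can be spread out further into
\<open>2\<^sup>-\<^sup>N \<sigma>(2\<^sup>N) g\<close> by averaging over rearrangements, and the point is that all \<open>N + 1\<close> of
them can be spread out simultaneously, by averages of functions whose distribution is bounded
by that of \<open>f\<close>.  Averaging does not increase the norm, so
\<open>(N + 1) \<parallel>\<sigma>(2\<^sup>N) g\<parallel> / 2\<^sup>N \<le> 16 \<parallel>f\<parallel>\<close> (\<open>dilation_bound_of_dyadic_domination\<close>).
Letting \<open>N\<close> grow gives \<open>c = 0\<close>.\<close>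

section \<open>Distribution functions and decreasing rearrangements\<close>

definition distribution :: "(real \<Rightarrow> real) \<Rightarrow> real \<Rightarrow> ennreal" where
  "distribution x s = emeasure half_line {u \<in> {0<..}. s < \<bar>x u\<bar>}"

lemma emeasure_half_line:
  "A \<subseteq> {0<..} \<Longrightarrow> emeasure half_line A = emeasure lebesgue A"
  by (rule emeasure_restrict_space) auto

lemma sets_half_line_iff:
  "A \<in> sets half_line \<longleftrightarrow> A \<in> sets lebesgue \<and> A \<subseteq> {0<..}"
  by (subst sets_restrict_space_iff) auto

lemma sigma_finite_half_line: "sigma_finite_measure half_line"
proof
  let ?A = "range (\<lambda>n. {0<..real n})"
  have "\<Union>?A = space half_line"
    using real_arch_simple by auto
  moreover have "?A \<subseteq> sets half_line"
    by (auto simp: sets_restrict_space_iff)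
  moreover have "emeasure half_line {0<..real n} = ennreal (real n)" for n
    by (subst emeasure_half_line) auto
  then have "\<forall>a\<in>?A. emeasure half_line a \<noteq> \<infinity>"
    by auto
  ultimately show "\<exists>A. countable A \<and> A \<subseteq> sets half_line \<and> \<Union>A = space half_line \<and>
      (\<forall>a\<in>A. emeasure half_line a \<noteq> \<infinity>)"
    by (intro exI[of _ ?A]) auto
qed

text \<open>Two functions with the same distribution have the same integral, and this is the formula
that shows it.\<close>

lemma layer_cake:
  fixes f :: "'a \<Rightarrow> real"
  assumes "sigma_finite_measure M" and [measurable]: "f \<in> borel_measurable M"
    and nonneg: "\<And>u. 0 \<le> f u"
  shows "(\<integral>\<^sup>+u. ennreal (f u) \<partial>M) =
         (\<integral>\<^sup>+s. indicator {0..} s * emeasure M {u \<in> space M. s < f u} \<partial>lborel)"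
proof -
  interpret sigma_finite_measure M by fact
  interpret pair_sigma_finite M lborel ..
  have slice: "ennreal (f u) = (\<integral>\<^sup>+s. (if 0 \<le> s \<and> s < f u then 1 else 0) \<partial>lborel)" for u
  proof -
    have "ennreal (f u) = emeasure lborel {0..<f u}"
      using nonneg[of u] by simp
    also have "\<dots> = (\<integral>\<^sup>+s. indicator {0..<f u} s \<partial>lborel)"
      by simp
    also have "\<dots> = (\<integral>\<^sup>+s. (if 0 \<le> s \<and> s < f u then 1 else 0) \<partial>lborel)"
      by (intro nn_integral_cong) (auto simp: indicator_def)
    finally show ?thesis .
  qed
  have "(\<integral>\<^sup>+u. ennreal (f u) \<partial>M) =
      (\<integral>\<^sup>+u. (\<integral>\<^sup>+s. (if 0 \<le> s \<and> s < f u then 1 else 0) \<partial>lborel) \<partial>M)"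
    using slice by (rule nn_integral_cong)
  also have "\<dots> = (\<integral>\<^sup>+s. (\<integral>\<^sup>+u. (if 0 \<le> s \<and> s < f u then 1 else 0) \<partial>M) \<partial>lborel)"
    by (rule Fubini'[symmetric]) measurable
  also have "\<dots> = (\<integral>\<^sup>+s. indicator {0..} s * emeasure M {u \<in> space M. s < f u} \<partial>lborel)"
  proof (rule nn_integral_cong)
    fix s :: real
    have "(\<integral>\<^sup>+u. (if 0 \<le> s \<and> s < f u then 1 else 0) \<partial>M) =
        (\<integral>\<^sup>+u. indicator {0..} s * indicator {u \<in> space M. s < f u} u \<partial>M)"
      by (intro nn_integral_cong) (auto simp: indicator_def)
    also have "\<dots> = indicator {0..} s * emeasure M {u \<in> space M. s < f u}"
      by (subst nn_integral_cmult) auto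
    finally show "(\<integral>\<^sup>+u. (if 0 \<le> s \<and> s < f u then 1 else 0) \<partial>M) =
        indicator {0..} s * emeasure M {u \<in> space M. s < f u}" .
  qed
  finally show ?thesis .
qed

lemma level_set_measurable:
  fixes x :: "real \<Rightarrow> real"
  assumes "x \<in> borel_measurable half_line"
  shows "{u \<in> {0<..}. s < \<bar>x u\<bar>} \<in> sets half_line"
proof -
  have "{u \<in> space half_line. s < \<bar>x u\<bar>} \<in> sets half_line"
    using borel_measurable_abs[OF assms] unfolding borel_measurable_iff_greater by blast
  then show ?thesis by simp
qed

lemma distribution_antimono:
  assumes "x \<in> borel_measurable half_line" "s \<le> s'"
  shows "distribution x s' \<le> distribution x s"
  unfolding distribution_def
  using level_set_measurable[OF assms(1)] assms(2) by (intro emeasure_mono) auto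

lemma L1_plus_Linf_measurable:
  assumes "x \<in> L1_plus_Linf"
  shows "x \<in> borel_measurable half_line"
proof -
  from assms obtain g h where g: "integrable half_line g" and h: "h \<in> borel_measurable half_line"
    and x: "\<forall>t>0. x t = g t + h t"
    unfolding L1_plus_Linf_def by blast
  have "(\<lambda>t. g t + h t) \<in> borel_measurable half_line"
    using g h by measurable
  then show ?thesis
    by (rule measurable_cong[THEN iffD1, rotated]) (use x in auto)
qed

text \<open>The bounded summand is integrable because the set has finite measure.\<close>

lemma L1_plus_Linf_integrable_on:
  assumes x: "x \<in> L1_plus_Linf" and A: "A \<in> sets half_line" "emeasure half_line A < \<infinity>"
  shows "integrable half_line (\<lambda>t. x t * indicator A t)"
proof -
  obtain g h C where g: "integrable half_line g" and h: "h \<in> borel_measurable half_line"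
    and C: "AE t in half_line. \<bar>h t\<bar> \<le> C" and x': "\<forall>t>0. x t = g t + h t"
    using x unfolding L1_plus_Linf_def by blast
  have 1: "integrable half_line (\<lambda>t. g t * indicator A t)"
    using integrable_mult_indicator[OF A(1) g] by (simp add: mult.commute)
  have 2: "integrable half_line (\<lambda>t. h t * indicator A t)"
  proof (rule Bochner_Integration.integrable_bound)
    show "integrable half_line (\<lambda>t. C * indicator A t)"
      using A by (intro integrable_mult_right) auto
    show "(\<lambda>t. h t * indicator A t) \<in> borel_measurable half_line"
      using h A(1) by measurable
    show "AE t in half_line. norm (h t * indicator A t) \<le> norm (C * indicator A t :: real)"
      using C by eventually_elim (auto simp: indicator_def)
  qed
  from Bochner_Integration.integrable_add[OF 1 2] show ?thesis
    by (rule Bochner_Integration.integrable_cong[THEN iffD1, rotated 2]) (use x' in \<open>auto simp: algebra_simps\<close>)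
qed

text \<open>Above the level \<open>C\<close> bounding the \<open>L\<^sub>\<infinity>\<close> summand only the integrable summand contributes, and
Markov's inequality applies to it.  In particular the infimum defining the rearrangement is
over a nonempty set.\<close>

lemma distribution_small:
  assumes x: "x \<in> L1_plus_Linf" and t: "0 < t"
  obtains s where "0 \<le> s" "distribution x s \<le> ennreal t"
proof -
  obtain g h C where g: "integrable half_line g" and h: "h \<in> borel_measurable half_line"
    and C: "AE t in half_line. \<bar>h t\<bar> \<le> C" and x': "\<forall>t>0. x t = g t + h t"
    using x unfolding L1_plus_Linf_def by blast
  define I where "I = (\<integral>u. \<bar>g u\<bar> \<partial>half_line)"
  define r where "r = (I + 1) / t"
  have I: "0 \<le> I" unfolding I_def by simp
  have r: "0 < r" using I t by (simp add: r_def)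
  have gm: "g \<in> borel_measurable half_line" using g by simp
  have "distribution x (\<bar>C\<bar> + r) \<le> emeasure half_line {u \<in> {0<..}. r \<le> \<bar>g u\<bar>}"
    unfolding distribution_def
  proof (rule emeasure_mono_AE)
    show "AE u in half_line. u \<in> {u \<in> {0<..}. \<bar>C\<bar> + r < \<bar>x u\<bar>} \<longrightarrow> u \<in> {u \<in> {0<..}. r \<le> \<bar>g u\<bar>}"
      using C by eventually_elim (use x' in auto)
    have "{u \<in> space half_line. r \<le> \<bar>g u\<bar>} \<in> sets half_line"
      using gm by measurable
    then show "{u \<in> {0<..}. r \<le> \<bar>g u\<bar>} \<in> sets half_line" by simp
  qed
  also have "\<dots> \<le> ennreal (I / r)"
  proof -
    have "emeasure half_line {u \<in> space half_line. r \<le> \<bar>g u\<bar>} \<le> ennreal ((1 / r) * I)"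
      unfolding I_def using g r by (intro integral_Markov_inequality) auto
    then show ?thesis by simp
  qed
  also have "\<dots> \<le> ennreal t"
  proof (rule ennreal_leI)
    show "I / r \<le> t" using I t by (simp add: r_def field_simps)
  qed
  finally show ?thesis using r by (intro that[of "\<bar>C\<bar> + r"]) auto
qed

text \<open>The distribution function is right continuous, so the infimum defining the rearrangement is
attained.  This Galois connection between rearrangement and distribution function carries the
properties of the rearrangement proved below.\<close>

lemma decr_rearr_le_iff:
  assumes x: "x \<in> L1_plus_Linf" and t: "0 < t" and s: "0 \<le> s"
  shows "decr_rearr x t \<le> s \<longleftrightarrow> distribution x s \<le> ennreal t"
proof -
  let ?S = "{s. 0 \<le> s \<and> distribution x s \<le> ennreal t}"
  have mx: "x \<in> borel_measurable half_line" by (rule L1_plus_Linf_measurable[OF x])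
  have eq: "decr_rearr x t = Inf ?S"
    by (simp add: decr_rearr_def distribution_def)
  have ne: "?S \<noteq> {}" using distribution_small[OF x t] by blast
  have bdd: "bdd_below ?S" by (rule bdd_belowI[of _ 0]) auto
  show ?thesis
  proof
    assume "distribution x s \<le> ennreal t"
    then show "decr_rearr x t \<le> s" unfolding eq using s bdd by (intro cInf_lower) auto
  next
    assume le: "decr_rearr x t \<le> s"
    have above: "distribution x s' \<le> ennreal t" if "s < s'" for s'
    proof -
      from le that have "Inf ?S < s'" unfolding eq by simp
      then obtain r where "r \<in> ?S" "r < s'" using cInf_lessD[OF ne] by blast
      then show ?thesis using distribution_antimono[OF mx, of r s'] by auto
    qed
    define B where "B n = {u \<in> {0<..}. s + 1 / real (Suc n) < \<bar>x u\<bar>}" for n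
    have Un: "(\<Union>n. B n) = {u \<in> {0<..}. s < \<bar>x u\<bar>}"
    proof (intro equalityI subsetI)
      fix u assume "u \<in> {u \<in> {0<..}. s < \<bar>x u\<bar>}"
      then have u: "0 < u" "0 < \<bar>x u\<bar> - s" by auto
      then obtain n where "inverse (real (Suc n)) < \<bar>x u\<bar> - s"
        using reals_Archimedean by blast
      with u show "u \<in> (\<Union>n. B n)" by (auto simp: B_def field_simps intro!: exI[of _ n])
    next
      fix u assume "u \<in> (\<Union>n. B n)"
      then obtain n where n: "0 < u" "s + 1 / real (Suc n) < \<bar>x u\<bar>" by (auto simp: B_def)
      have "0 < 1 / real (Suc n)" by simp
      with n have "s < \<bar>x u\<bar>" by linarith
      with n show "u \<in> {u \<in> {0<..}. s < \<bar>x u\<bar>}" by simp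
    qed
    have "incseq B"
      unfolding B_def
    proof (intro monoI subsetI CollectI, elim CollectE conjE, intro conjI)
      fix m n u assume "m \<le> n" and *: "s + 1 / real (Suc m) < \<bar>x u\<bar>"
      then have "1 / real (Suc n) \<le> 1 / real (Suc m)" by (simp add: field_simps)
      with * show "s + 1 / real (Suc n) < \<bar>x u\<bar>" by linarith
    qed
    moreover have "range B \<subseteq> sets half_line"
      unfolding B_def using level_set_measurable[OF mx] by blast
    ultimately have "(SUP n. emeasure half_line (B n)) = emeasure half_line (\<Union>n. B n)"
      by (intro SUP_emeasure_incseq)
    then have "distribution x s = (SUP n. emeasure half_line (B n))"
      by (simp add: distribution_def Un)
    also have "\<dots> \<le> ennreal t"
    proof (rule SUP_least)
      fix n
      have "distribution x (s + 1 / real (Suc n)) \<le> ennreal t"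
        by (rule above) simp
      then show "emeasure half_line (B n) \<le> ennreal t" by (simp add: B_def distribution_def)
    qed
    finally show "distribution x s \<le> ennreal t" .
  qed
qed

lemma decr_rearr_nonneg:
  assumes x: "x \<in> L1_plus_Linf" and t: "0 < t"
  shows "0 \<le> decr_rearr x t"
  unfolding decr_rearr_def distribution_def[symmetric]
  by (rule cInf_greatest) (use distribution_small[OF x t] in auto)

lemma distribution_decr_rearr_le:
  assumes x: "x \<in> L1_plus_Linf" and t: "0 < t"
  shows "distribution x (decr_rearr x t) \<le> ennreal t"
  using decr_rearr_le_iff[OF assms, of "decr_rearr x t"] decr_rearr_nonneg[OF assms] by simp

lemma decr_rearr_antimono:
  assumes x: "x \<in> L1_plus_Linf" and "0 < t" "t \<le> t'"
  shows "decr_rearr x t' \<le> decr_rearr x t"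
  using decr_rearr_le_iff[OF x, of t' "decr_rearr x t"] distribution_decr_rearr_le[OF x, of t]
    decr_rearr_nonneg[OF x, of t] assms(2,3) by (auto intro: order_trans ennreal_leI)

lemma decr_rearr_mono:
  assumes "x \<in> L1_plus_Linf" "y \<in> L1_plus_Linf" "\<And>s. 0 \<le> s \<Longrightarrow> distribution x s \<le> distribution y s"
    and t: "0 < t"
  shows "decr_rearr x t \<le> decr_rearr y t"
  using decr_rearr_le_iff[OF assms(1) t, of "decr_rearr y t"] decr_rearr_nonneg[OF assms(2) t]
    distribution_decr_rearr_le[OF assms(2) t] assms(3)[of "decr_rearr y t"] by auto

lemma ennreal_le_if_upper_bounds:
  fixes a b :: ennreal
  assumes "\<And>t::real. 0 < t \<Longrightarrow> b \<le> ennreal t \<Longrightarrow> a \<le> ennreal t"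
  shows "a \<le> b"
proof (rule ccontr)
  assume "\<not> a \<le> b"
  then have "b < a" by simp
  then obtain c where c: "b < c" "c < a" using dense by blast
  have "c < \<infinity>" using c(2) by (rule less_le_trans) simp
  moreover have "0 < c" using c(1) by (rule le_less_trans[rotated]) simp
  ultimately obtain t where "c = ennreal t" "0 < t"
    by (cases c) (auto simp: ennreal_zero_less_top)
  then show False using assms[of t] c by (auto dest: leD less_imp_le)
qed

lemma equimeasurable_iff_distribution:
  assumes x: "x \<in> L1_plus_Linf" and y: "y \<in> L1_plus_Linf"
  shows "equimeasurable x y \<longleftrightarrow> (\<forall>s\<ge>0. distribution x s = distribution y s)"
proof
  assume eq: "equimeasurable x y"
  show "\<forall>s\<ge>0. distribution x s = distribution y s"
  proof (intro allI impI)
    fix s :: real assume "0 \<le> s"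
    then have *: "distribution x s \<le> ennreal t \<longleftrightarrow> distribution y s \<le> ennreal t" if "0 < t" for t
      using decr_rearr_le_iff[OF x that] decr_rearr_le_iff[OF y that] eq that
      by (auto simp: equimeasurable_def)
    show "distribution x s = distribution y s"
      by (rule antisym; rule ennreal_le_if_upper_bounds) (use * in auto)
  qed
next
  assume "\<forall>s\<ge>0. distribution x s = distribution y s"
  then show "equimeasurable x y"
    unfolding equimeasurable_def by (auto intro!: antisym decr_rearr_mono x y)
qed

text \<open>The level sets of a rearrangement have this form; \<open>D\<close> may be infinite.\<close>

lemma initial_segment:
  shows "{t. 0 < t \<and> ennreal t < D} \<in> sets half_line"
    and "emeasure half_line {t. 0 < t \<and> ennreal t < D} = D"
proof -
  have "{t. 0 < t \<and> ennreal t < D} \<in> sets half_line \<and>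
    emeasure half_line {t. 0 < t \<and> ennreal t < D} = D"
  proof (cases D)
    case (real d)
    then have *: "{t. 0 < t \<and> ennreal t < D} = {0<..<d}"
      by (auto simp: ennreal_less_iff)
    show ?thesis unfolding * using real
      by (subst emeasure_half_line) (auto simp: sets_half_line_iff)
  next
    case top
    then have *: "{t. 0 < t \<and> ennreal t < D} = {0<..}"
      by auto
    have "emeasure lborel {0::real<..} = \<infinity>"
    proof (rule ccontr)
      assume "emeasure lborel {0::real<..} \<noteq> \<infinity>"
      then obtain n where n: "emeasure lborel {0::real<..} < of_nat n"
        using ennreal_Ex_less_of_nat by (auto simp: less_top)
      have "emeasure lborel {0<..real n} \<le> emeasure lborel {0::real<..}"
        by (intro emeasure_mono) auto
      with n show False by (simp add: ennreal_of_nat_eq_real_of_nat leD)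
    qed
    then show ?thesis unfolding * using top
      by (subst emeasure_half_line) (auto simp: sets_half_line_iff)
  qed
  then show "{t. 0 < t \<and> ennreal t < D} \<in> sets half_line"
    "emeasure half_line {t. 0 < t \<and> ennreal t < D} = D" by auto
qed

lemma half_line_borelI:
  assumes "A \<in> sets borel" "A \<subseteq> {0::real<..}"
  shows "A \<in> sets half_line"
  using assms by (simp add: sets_half_line_iff)

lemma half_line_measurableI:
  fixes f :: "real \<Rightarrow> real"
  assumes "\<And>a. {u \<in> {0<..}. a < f u} \<in> sets half_line"
  shows "f \<in> borel_measurable half_line"
  unfolding borel_measurable_iff_greater using assms by simp

lemma half_line_greater_sets:
  fixes f :: "real \<Rightarrow> real"
  assumes "f \<in> borel_measurable half_line"
  shows "{u \<in> {0<..}. a < f u} \<in> sets half_line"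
  using assms unfolding borel_measurable_iff_greater by simp

lemma decr_rearr_greater_iff:
  assumes x: "x \<in> L1_plus_Linf" and t: "0 < t" and s: "0 \<le> s"
  shows "s < decr_rearr x t \<longleftrightarrow> ennreal t < distribution x s"
  using decr_rearr_le_iff[OF assms] by (simp add: not_le[symmetric])

lemma decr_rearr_measurable:
  assumes x: "x \<in> L1_plus_Linf"
  shows "decr_rearr x \<in> borel_measurable half_line"
proof (rule half_line_measurableI)
  fix a :: real
  show "{u \<in> {0<..}. a < decr_rearr x u} \<in> sets half_line"
  proof (cases "0 \<le> a")
    case True
    then have "{u \<in> {0<..}. a < decr_rearr x u} = {t. 0 < t \<and> ennreal t < distribution x a}"
      using decr_rearr_greater_iff[OF x] by auto
    then show ?thesis using initial_segment(1) by simp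
  next
    case False
    then have "{u \<in> {0<..}. a < decr_rearr x u} = {0<..}"
      using decr_rearr_nonneg[OF x] by (force intro: less_le_trans)
    then show ?thesis by simp
  qed
qed

lemma distribution_decr_rearr:
  assumes x: "x \<in> L1_plus_Linf" and s: "0 \<le> s"
  shows "distribution (decr_rearr x) s = distribution x s"
proof -
  have "{u \<in> {0<..}. s < \<bar>decr_rearr x u\<bar>} = {t. 0 < t \<and> ennreal t < distribution x s}"
    using decr_rearr_greater_iff[OF x _ s] decr_rearr_nonneg[OF x] by auto
  then show ?thesis unfolding distribution_def[of "decr_rearr x"]
    by (simp only: initial_segment(2))
qed

text \<open>The part of \<open>x\<close> above the level \<open>s0\<close> has the distribution \<open>s \<mapsto> distribution x (max s s0)\<close>,
so its integral depends on the distribution of \<open>x\<close> only and is monotone in it.\<close>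

lemma nn_integral_above_level:
  assumes x: "x \<in> borel_measurable half_line" and s0: "0 \<le> s0"
  shows "(\<integral>\<^sup>+u. ennreal (\<bar>x u\<bar> * indicator {u \<in> {0<..}. s0 < \<bar>x u\<bar>} u) \<partial>half_line) =
         (\<integral>\<^sup>+s. indicator {0..} s * distribution x (max s s0) \<partial>lborel)"
proof -
  have "(\<lambda>u. \<bar>x u\<bar> * indicator {u \<in> {0<..}. s0 < \<bar>x u\<bar>} u) \<in> borel_measurable half_line"
    by (rule borel_measurable_times[OF borel_measurable_abs[OF x]
          borel_measurable_indicator[OF level_set_measurable[OF x]]])
  then have "(\<integral>\<^sup>+u. ennreal (\<bar>x u\<bar> * indicator {u \<in> {0<..}. s0 < \<bar>x u\<bar>} u) \<partial>half_line) =
    (\<integral>\<^sup>+s. indicator {0..} s * emeasure half_line {u \<in> space half_line.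
        s < \<bar>x u\<bar> * indicator {u \<in> {0<..}. s0 < \<bar>x u\<bar>} u} \<partial>lborel)"
    by (intro layer_cake sigma_finite_half_line) auto
  also have "\<dots> = (\<integral>\<^sup>+s. indicator {0..} s * distribution x (max s s0) \<partial>lborel)"
  proof (intro nn_integral_cong)
    fix s :: real
    have "{u \<in> space half_line. s < \<bar>x u\<bar> * indicator {u \<in> {0<..}. s0 < \<bar>x u\<bar>} u} =
        {u \<in> {0<..}. max s s0 < \<bar>x u\<bar>}" if "0 \<le> s"
      using that s0 by (auto simp: indicator_def split: if_splits)
    then show "indicator {0..} s * emeasure half_line {u \<in> space half_line.
        s < \<bar>x u\<bar> * indicator {u \<in> {0<..}. s0 < \<bar>x u\<bar>} u} =
        indicator {0..} s * distribution x (max s s0)"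
      by (auto simp: indicator_def distribution_def)
  qed
  finally show ?thesis .
qed

lemma L1_plus_Linf_abs_integrable_above_level:
  assumes x: "x \<in> L1_plus_Linf" and fin: "distribution x s < \<infinity>"
  shows "integrable half_line (\<lambda>t. \<bar>x t\<bar> * indicator {u \<in> {0<..}. s < \<bar>x u\<bar>} t)"
proof -
  have "integrable half_line (\<lambda>t. x t * indicator {u \<in> {0<..}. s < \<bar>x u\<bar>} t)"
    using fin unfolding distribution_def
    by (rule L1_plus_Linf_integrable_on[OF x level_set_measurable[OF L1_plus_Linf_measurable[OF x]]])
  then have "integrable half_line (\<lambda>t. \<bar>x t * indicator {u \<in> {0<..}. s < \<bar>x u\<bar>} t\<bar>)"
    by (rule integrable_abs)
  then show ?thesis by (simp add: abs_mult)
qed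

text \<open>Membership in \<open>L\<^sub>1 + L\<^sub>\<infinity>\<close> depends on the distribution only: cutting at a level that \<open>x\<close>
exceeds on a set of measure at most 1 leaves an integrable upper part.\<close>

lemma L1_plus_Linf_if_distribution_le:
  assumes x: "x \<in> L1_plus_Linf" and y: "y \<in> borel_measurable half_line"
    and le: "\<And>s. 0 \<le> s \<Longrightarrow> distribution y s \<le> distribution x s"
  shows "y \<in> L1_plus_Linf"
proof -
  obtain s0 where s0: "0 \<le> s0" "distribution x s0 \<le> ennreal 1"
    using distribution_small[OF x, of 1] by auto
  have mx: "x \<in> borel_measurable half_line" by (rule L1_plus_Linf_measurable[OF x])
  define B where "B = {u \<in> {0<..}. s0 < \<bar>y u\<bar>}"
  have B: "B \<in> sets half_line" unfolding B_def by (rule level_set_measurable[OF y])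
  have "(\<integral>\<^sup>+u. ennreal (\<bar>y u\<bar> * indicator B u) \<partial>half_line) =
         (\<integral>\<^sup>+s. indicator {0..} s * distribution y (max s s0) \<partial>lborel)"
    unfolding B_def by (rule nn_integral_above_level[OF y s0(1)])
  also have "\<dots> \<le> (\<integral>\<^sup>+s. indicator {0..} s * distribution x (max s s0) \<partial>lborel)"
    by (intro nn_integral_mono mult_left_mono le) (use s0 in auto)
  also have "\<dots> = (\<integral>\<^sup>+u. ennreal (\<bar>x u\<bar> * indicator {u \<in> {0<..}. s0 < \<bar>x u\<bar>} u) \<partial>half_line)"
    by (rule nn_integral_above_level[OF mx s0(1), symmetric])
  also have "\<dots> < \<infinity>"
  proof -
    have "integrable half_line (\<lambda>t. \<bar>x t\<bar> * indicator {u \<in> {0<..}. s0 < \<bar>x u\<bar>} t)"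
      using s0 by (intro L1_plus_Linf_abs_integrable_above_level[OF x]) (auto intro: le_less_trans)
    then show ?thesis by (auto simp: integrable_iff_bounded abs_mult)
  qed
  finally have "integrable half_line (\<lambda>u. y u * indicator B u)"
    unfolding integrable_iff_bounded using y B
    by (auto simp: abs_mult intro!: borel_measurable_times)
  moreover have "(\<lambda>u. y u * indicator (- B) u) \<in> borel_measurable half_line"
  proof -
    have "(\<lambda>u. y u - y u * indicator B u) \<in> borel_measurable half_line"
      using y B by (intro borel_measurable_diff borel_measurable_times borel_measurable_indicator)
    then show ?thesis
      by (rule measurable_cong[THEN iffD1, rotated]) (auto simp: indicator_def)
  qed
  moreover have "AE u in half_line. \<bar>y u * indicator (- B) u\<bar> \<le> s0"
    using s0 by (intro AE_I2) (auto simp: B_def indicator_def)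
  moreover have "\<forall>t>0. y t = y t * indicator B t + y t * indicator (- B) t"
    by (auto simp: indicator_def)
  ultimately show ?thesis unfolding L1_plus_Linf_def by blast
qed

lemma decr_rearr_mem_L1_plus_Linf:
  assumes "x \<in> L1_plus_Linf"
  shows "decr_rearr x \<in> L1_plus_Linf"
  by (rule L1_plus_Linf_if_distribution_le[OF assms decr_rearr_measurable[OF assms]])
     (simp add: distribution_decr_rearr[OF assms])

section \<open>Norm estimates from distribution functions\<close>

context symmetric_banach_space
begin

lemma mem_L1_plus_Linf: "x \<in> E \<Longrightarrow> x \<in> L1_plus_Linf"
  using subset by auto

lemma mem_measurable: "x \<in> E \<Longrightarrow> x \<in> borel_measurable half_line"
  by (rule L1_plus_Linf_measurable[OF mem_L1_plus_Linf])

lemma decr_rearr_mem: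
  assumes "x \<in> E"
  shows "decr_rearr x \<in> E" "nrm (decr_rearr x) = nrm x"
proof -
  have x: "x \<in> L1_plus_Linf" by (rule mem_L1_plus_Linf[OF assms])
  have eq: "equimeasurable (decr_rearr x) x"
    using equimeasurable_iff_distribution[OF decr_rearr_mem_L1_plus_Linf[OF x] x]
      distribution_decr_rearr[OF x] by auto
  show "decr_rearr x \<in> E" "nrm (decr_rearr x) = nrm x"
    using rearrangement[OF assms decr_rearr_mem_L1_plus_Linf[OF x] eq] by auto
qed

text \<open>The two axioms on rearrangement and solidity combine to this single principle, by which
elements of \<open>E\<close> are compared below: \<open>y\<^sup>* \<le> x\<^sup>*\<close> holds pointwise, and \<open>x\<close>, \<open>y\<close> may be
exchanged for their rearrangements.\<close>

lemma distribution_le_mem: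
  assumes x: "x \<in> E" and y: "y \<in> borel_measurable half_line"
    and le: "\<And>s. 0 \<le> s \<Longrightarrow> distribution y s \<le> distribution x s"
  shows "y \<in> E" "nrm y \<le> nrm x"
proof -
  note xL = mem_L1_plus_Linf[OF x]
  have yL: "y \<in> L1_plus_Linf" by (rule L1_plus_Linf_if_distribution_le[OF xL y le])
  have "AE t in half_line. 0 \<le> decr_rearr y t \<and> decr_rearr y t \<le> decr_rearr x t"
    by (rule AE_I2) (simp add: decr_rearr_nonneg[OF yL] decr_rearr_mono[OF yL xL le])
  from solid[OF decr_rearr_mem(1)[OF x] decr_rearr_measurable[OF yL] this]
  have *: "decr_rearr y \<in> E" "nrm (decr_rearr y) \<le> nrm x"
    using decr_rearr_mem(2)[OF x] by auto
  have "equimeasurable y (decr_rearr y)"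
    using equimeasurable_iff_distribution[OF yL decr_rearr_mem_L1_plus_Linf[OF yL]]
      distribution_decr_rearr[OF yL] by auto
  from rearrangement[OF *(1) yL this] * show "y \<in> E" "nrm y \<le> nrm x" by auto
qed

lemma abs_le_mem:
  assumes x: "x \<in> E" and y: "y \<in> borel_measurable half_line"
    and le: "AE t in half_line. \<bar>y t\<bar> \<le> \<bar>x t\<bar>"
  shows "y \<in> E" "nrm y \<le> nrm x"
proof -
  have *: "distribution y s \<le> distribution x s" if "0 \<le> s" for s
    unfolding distribution_def
  proof (rule emeasure_mono_AE)
    show "AE u in half_line. u \<in> {u \<in> {0<..}. s < \<bar>y u\<bar>} \<longrightarrow> u \<in> {u \<in> {0<..}. s < \<bar>x u\<bar>}"
      using le by eventually_elim auto
  qed (rule level_set_measurable[OF mem_measurable[OF x]])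
  show "y \<in> E" "nrm y \<le> nrm x"
    by (rule distribution_le_mem[OF x y], erule *)+
qed

lemma sum_mem:
  assumes "finite I" "\<And>i. i \<in> I \<Longrightarrow> f i \<in> E"
  shows "(\<lambda>t. \<Sum>i\<in>I. f i t) \<in> E" and "nrm (\<lambda>t. \<Sum>i\<in>I. f i t) \<le> (\<Sum>i\<in>I. nrm (f i))"
proof -
  have "(\<lambda>t. \<Sum>i\<in>I. f i t) \<in> E \<and> nrm (\<lambda>t. \<Sum>i\<in>I. f i t) \<le> (\<Sum>i\<in>I. nrm (f i))"
    using assms
  proof (induction I rule: finite_induct)
    case empty
    then show ?case using zero_mem nrm_eq_0_iff[OF zero_mem] by simp
  next
    case (insert i I)
    then have "(\<lambda>t. \<Sum>i\<in>I. f i t) \<in> E" "nrm (\<lambda>t. \<Sum>i\<in>I. f i t) \<le> (\<Sum>i\<in>I. nrm (f i))" "f i \<in> E"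
      by auto
    with insert.hyps add_mem[of "f i" "\<lambda>t. \<Sum>i\<in>I. f i t"] nrm_triangle[of "f i" "\<lambda>t. \<Sum>i\<in>I. f i t"]
    show ?case by simp
  qed
  then show "(\<lambda>t. \<Sum>i\<in>I. f i t) \<in> E" "nrm (\<lambda>t. \<Sum>i\<in>I. f i t) \<le> (\<Sum>i\<in>I. nrm (f i))"
    by auto
qed

end

text \<open>Copies of a function are placed disjointly by interleaving unit cells: the \<open>q\<close>-th unit cell
of the \<open>i\<close>-th copy becomes the unit cell with number \<open>k q + i\<close>.  The map below reads off the
position inside the copy, and the set after it is the part of the \<open>i\<close>-th copy that lies
over \<open>A\<close>.\<close>

definition collapse_cells :: "nat \<Rightarrow> real \<Rightarrow> real" where
  "collapse_cells k t = t - real (nat \<lfloor>t\<rfloor>) + real (nat \<lfloor>t\<rfloor> div k)"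

definition cells_preimage :: "nat \<Rightarrow> nat \<Rightarrow> real set \<Rightarrow> real set" where
  "cells_preimage k i A = {t \<in> {0<..}. nat \<lfloor>t\<rfloor> mod k = i \<and> collapse_cells k t \<in> A}"

text \<open>The preimage is obtained by translating the intersections of \<open>A\<close> with the unit cells.\<close>

lemma cells_preimage_measure:
  assumes A: "A \<in> sets half_line" and i: "i < k"
  shows "cells_preimage k i A \<in> sets half_line"
    and "emeasure half_line (cells_preimage k i A) = emeasure half_line A"
proof -
  define B where "B q = A \<inter> {real q..<real q + 1}" for q
  define c where "c q = real (k * q + i) - real q" for q
  have A': "A \<in> sets lebesgue" "A \<subseteq> {0<..}" using A by (auto simp: sets_half_line_iff)
  have B: "B q \<in> sets lebesgue" for q unfolding B_def using A' by auto
  have c: "0 \<le> c q" for q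
  proof -
    have "q \<le> k * q + i" using i by (cases k) auto
    then have "real q \<le> real (k * q + i)" by (rule of_nat_mono)
    then show ?thesis unfolding c_def by simp
  qed
  have B_floor: "nat \<lfloor>t\<rfloor> = q" if "t \<in> B q" for t q
  proof -
    have "\<lfloor>t\<rfloor> = int q" using that by (intro floor_unique) (auto simp: B_def)
    then show ?thesis by simp
  qed
  have shift_floor: "nat \<lfloor>c q + t\<rfloor> = k * q + i" if "t \<in> B q" for t q
  proof -
    have "\<lfloor>c q + t\<rfloor> = int (k * q + i)"
      using that by (intro floor_unique) (auto simp: B_def c_def)
    then show ?thesis by (simp only: nat_int)
  qed
  have A_eq: "A = (\<Union>q. B q)"
  proof (intro equalityI subsetI)
    fix t assume t: "t \<in> A"
    then have "0 < t" using A' by auto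
    then have "real (nat \<lfloor>t\<rfloor>) \<le> t" "t < real (nat \<lfloor>t\<rfloor>) + 1" by linarith+
    with t show "t \<in> (\<Union>q. B q)" by (auto simp: B_def)
  qed (auto simp: B_def)
  have pre_eq: "cells_preimage k i A = (\<Union>q. (\<lambda>t. c q + t) ` B q)"
  proof (intro equalityI subsetI)
    fix t assume "t \<in> cells_preimage k i A"
    then have t: "0 < t" "nat \<lfloor>t\<rfloor> mod k = i" "collapse_cells k t \<in> A"
      by (auto simp: cells_preimage_def)
    define q where "q = nat \<lfloor>t\<rfloor> div k"
    have n: "nat \<lfloor>t\<rfloor> = k * q + i" using t(2) by (auto simp: q_def)
    have eq: "t = c q + collapse_cells k t"
      unfolding collapse_cells_def n c_def using i by simp
    have "real (nat \<lfloor>t\<rfloor>) \<le> t" "t < real (nat \<lfloor>t\<rfloor>) + 1" using t(1) by linarith+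
    then have "real q \<le> collapse_cells k t" "collapse_cells k t < real q + 1"
      unfolding collapse_cells_def q_def by linarith+
    then have "collapse_cells k t \<in> B q"
      using t(3) by (simp add: B_def)
    with eq show "t \<in> (\<Union>q. (\<lambda>t. c q + t) ` B q)" by blast
  next
    fix t assume "t \<in> (\<Union>q. (\<lambda>t. c q + t) ` B q)"
    then obtain q u where u: "u \<in> B q" "t = c q + u" by auto
    have f: "nat \<lfloor>t\<rfloor> = k * q + i" using shift_floor[OF u(1)] u(2) by simp
    have "collapse_cells k t = u"
      unfolding collapse_cells_def f using i u(2) by (simp add: c_def)
    moreover have "u \<in> A" "0 < u" using u(1) A' by (auto simp: B_def)
    moreover have "0 < t" using c[of q] \<open>0 < u\<close> u(2) by linarith
    ultimately show "t \<in> cells_preimage k i A"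
      unfolding cells_preimage_def using f i by simp
  qed
  have sets: "(\<lambda>t. c q + t) ` B q \<in> sets lebesgue" for q
    by (rule lebesgue_sets_translation[OF B])
  have "cells_preimage k i A \<in> sets lebesgue"
    unfolding pre_eq using sets by auto
  then show "cells_preimage k i A \<in> sets half_line"
    by (auto simp: sets_half_line_iff cells_preimage_def)
  have disj1: "disjoint_family B"
    using B_floor unfolding disjoint_family_on_def by blast
  have disj2: "disjoint_family (\<lambda>q. (\<lambda>t. c q + t) ` B q)"
  proof (unfold disjoint_family_on_def, intro ballI impI equals0I)
    fix p q t assume "p \<noteq> q" "t \<in> (\<lambda>t. c p + t) ` B p \<inter> (\<lambda>t. c q + t) ` B q"
    then obtain u w where "u \<in> B p" "t = c p + u" "w \<in> B q" "t = c q + w" by blast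
    then have "k * p + i = k * q + i" using shift_floor[of u p] shift_floor[of w q] by simp
    then show False using \<open>p \<noteq> q\<close> i by simp
  qed
  have "emeasure lebesgue (cells_preimage k i A) = (\<Sum>q. emeasure lebesgue ((\<lambda>t. c q + t) ` B q))"
    unfolding pre_eq using sets disj2 by (intro suminf_emeasure[symmetric]) auto
  also have "\<dots> = (\<Sum>q. emeasure lebesgue (B q))"
    using emeasure_lebesgue_affine[of 1 "c _" "B _"] by (simp add: add.commute)
  also have "\<dots> = emeasure lebesgue A"
    unfolding A_eq using B disj1 by (intro suminf_emeasure) auto
  finally show "emeasure half_line (cells_preimage k i A) = emeasure half_line A"
    using A'(2) by (simp add: emeasure_half_line cells_preimage_def subset_iff)
qed

text \<open>The sum of \<open>k\<close> disjoint copies of \<open>x\<close> has norm at most \<open>k \<parallel>x\<parallel>\<close> by the triangle inequality,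
and its distribution is exactly \<open>k\<close> times that of \<open>x\<close>.  That no further constant
enters is what the convergence of \<open>\<parallel>\<sigma>(m) x\<^sup>*\<parallel> / m\<close> depends on.\<close>

lemma (in symmetric_banach_space) distribution_le_copies:
  assumes x: "x \<in> E" and y: "y \<in> borel_measurable half_line" and k: "0 < k"
    and le: "\<And>s. 0 \<le> s \<Longrightarrow> distribution y s \<le> of_nat k * distribution x s"
  shows "y \<in> E" "nrm y \<le> real k * nrm x"
proof -
  define H where "H i t = (if nat \<lfloor>t\<rfloor> mod k = i \<and> 0 < collapse_cells k t then x (collapse_cells k t) else 0)" for i t
  have mx: "x \<in> borel_measurable half_line" by (rule mem_measurable[OF x])
  have Hm: "H i \<in> borel_measurable half_line" if i: "i < k" for i
  proof (rule half_line_measurableI)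
    fix a :: real
    let ?P = "\<lambda>A. cells_preimage k i A"
    have 1: "?P {u \<in> {0<..}. a < x u} \<in> sets half_line" "?P {0<..} \<in> sets half_line"
      using half_line_greater_sets[OF mx] by (auto intro!: cells_preimage_measure i)
    have "{u \<in> {0<..}. a < H i u} =
      (if a < 0 then ?P {u \<in> {0<..}. a < x u} \<union> ({0<..} - ?P {0<..}) else ?P {u \<in> {0<..}. a < x u})"
      by (auto simp: H_def cells_preimage_def)
    then show "{u \<in> {0<..}. a < H i u} \<in> sets half_line" using 1 by auto
  qed
  have level: "{u \<in> {0<..}. s < \<bar>H i u\<bar>} = cells_preimage k i {u \<in> {0<..}. s < \<bar>x u\<bar>}" if "0 \<le> s" for s i
    using that by (auto simp: H_def cells_preimage_def)
  have Hd: "distribution (H i) s = distribution x s" if "i < k" "0 \<le> s" for i s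
    unfolding distribution_def level[OF that(2)]
    by (rule cells_preimage_measure(2)[OF level_set_measurable[OF mx] that(1)])
  have HE: "H i \<in> E" "nrm (H i) \<le> nrm x" if "i < k" for i
    using distribution_le_mem[OF x Hm[OF that]] Hd[OF that] by auto
  define S where "S t = (\<Sum>i<k. H i t)" for t
  have S: "S \<in> E" "nrm S \<le> real k * nrm x"
  proof -
    show "S \<in> E" unfolding S_def[abs_def] using HE by (intro sum_mem) auto
    have "nrm S \<le> (\<Sum>i<k. nrm (H i))" unfolding S_def[abs_def] using HE by (intro sum_mem) auto
    also have "\<dots> \<le> (\<Sum>i<k. nrm x)" using HE by (intro sum_mono) auto
    finally show "nrm S \<le> real k * nrm x" by simp
  qed
  have S_eq: "S t = H (nat \<lfloor>t\<rfloor> mod k) t" for t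
  proof -
    have "S t = (\<Sum>i\<in>{nat \<lfloor>t\<rfloor> mod k}. H i t)"
      unfolding S_def by (rule sum.mono_neutral_right) (use k in \<open>auto simp: H_def\<close>)
    then show ?thesis by simp
  qed
  have Sd: "distribution S s = of_nat k * distribution x s" if s: "0 \<le> s" for s
  proof -
    have "{u \<in> {0<..}. s < \<bar>S u\<bar>} = (\<Union>i<k. cells_preimage k i {u \<in> {0<..}. s < \<bar>x u\<bar>})"
      unfolding level[OF s, symmetric] S_eq using k s by (auto simp: H_def)
    then have "distribution S s = emeasure half_line (\<Union>i<k. cells_preimage k i {u \<in> {0<..}. s < \<bar>x u\<bar>})"
      by (simp add: distribution_def)
    also have "\<dots> = (\<Sum>i<k. emeasure half_line (cells_preimage k i {u \<in> {0<..}. s < \<bar>x u\<bar>}))"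
      using cells_preimage_measure(1)[OF level_set_measurable[OF mx]]
      by (intro sum_emeasure[symmetric]) (auto simp: disjoint_family_on_def cells_preimage_def)
    also have "\<dots> = (\<Sum>i<k. distribution x s)"
      unfolding distribution_def
      by (intro sum.cong refl cells_preimage_measure(2) level_set_measurable mx) simp
    finally show ?thesis by simp
  qed
  have "distribution y s \<le> distribution S s" if "0 \<le> s" for s
    using le[OF that] Sd[OF that] by simp
  from distribution_le_mem[OF S(1) y this] S(2) show "y \<in> E" "nrm y \<le> real k * nrm x"
    by auto
qed

lemma dilation_level_set:
  assumes "0 < m"
  shows "{u \<in> {0<..}. P (dilation m x u)} = (\<lambda>u. m * u) ` {u \<in> {0<..}. P (x u)}"
proof (intro equalityI subsetI)
  fix u assume "u \<in> {u \<in> {0<..}. P (dilation m x u)}"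
  then show "u \<in> (\<lambda>u. m * u) ` {u \<in> {0<..}. P (x u)}"
    using assms by (intro image_eqI[of _ _ "u / m"]) (auto simp: dilation_def)
qed (use assms in \<open>auto simp: dilation_def\<close>)

lemma dilation_measurable:
  assumes x: "x \<in> borel_measurable half_line" and m: "0 < m"
  shows "dilation m x \<in> borel_measurable half_line"
proof (rule half_line_measurableI)
  fix a :: real
  let ?A = "{u \<in> {0<..}. a < x u}"
  have "?A \<in> sets lebesgue"
    using half_line_greater_sets[OF x] sets_half_line_iff by auto
  then have "(\<lambda>u. (1 / m) *\<^sub>R u) -` ?A \<inter> space lebesgue \<in> sets lebesgue"
    by (rule measurable_sets[OF lebesgue_measurable_scaling])
  also have "(\<lambda>u. (1 / m) *\<^sub>R u) -` ?A \<inter> space lebesgue = {u \<in> {0<..}. a < dilation m x u}"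
    using m by (auto simp: dilation_def zero_less_divide_iff)
  finally show "{u \<in> {0<..}. a < dilation m x u} \<in> sets half_line"
    by (auto simp: sets_half_line_iff)
qed

lemma distribution_dilation:
  assumes m: "0 < m"
  shows "distribution (dilation m x) s = ennreal m * distribution x s"
proof -
  have "distribution (dilation m x) s = emeasure lebesgue ((\<lambda>u. m * u) ` {u \<in> {0<..}. s < \<bar>x u\<bar>})"
    unfolding distribution_def dilation_level_set[OF m, of "\<lambda>v. s < \<bar>v\<bar>" x]
    using m by (intro emeasure_half_line) auto
  also have "\<dots> = ennreal m * emeasure lebesgue {u \<in> {0<..}. s < \<bar>x u\<bar>}"
    using emeasure_lebesgue_affine[of m 0 "{u \<in> {0<..}. s < \<bar>x u\<bar>}"] m by simp
  also have "\<dots> = ennreal m * distribution x s"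
    unfolding distribution_def by (subst emeasure_half_line) auto
  finally show ?thesis .
qed

section \<open>Distributing dyadic masses\<close>

text \<open>The slots that the multiplicities leave free hold the value 0, which contributes nothing to the
sum and exceeds no level \<open>s \<ge> 0\<close>.\<close>

lemma values_from_multiplicities:
  fixes m :: "nat \<Rightarrow> nat" and \<phi> :: "nat \<Rightarrow> real"
  assumes "(\<Sum>k<K. m k) \<le> M" and "\<And>k. 0 \<le> \<phi> k"
  shows "\<exists>v. (\<forall>c. 0 \<le> v c) \<and> (\<Sum>c<M. v c) = (\<Sum>k<K. real (m k) * \<phi> k) \<and>
    (\<forall>s\<ge>0. card {c. c < M \<and> s < v c} \<le> (\<Sum>k<K. if s < \<phi> k then m k else 0))"
  using assms(1)
proof (induction K arbitrary: M)
  case 0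
  then show ?case by (intro exI[of _ "\<lambda>_. 0"]) auto
next
  case (Suc K)
  define M' where "M' = M - m K"
  have M: "M = M' + m K" "(\<Sum>k<K. m k) \<le> M'"
    using Suc.prems by (auto simp: M'_def)
  obtain v where v: "\<forall>c. 0 \<le> v c" "(\<Sum>c<M'. v c) = (\<Sum>k<K. real (m k) * \<phi> k)"
    "\<forall>s\<ge>0. card {c. c < M' \<and> s < v c} \<le> (\<Sum>k<K. if s < \<phi> k then m k else 0)"
    using Suc.IH[OF M(2)] by blast
  define w where "w c = (if c < M' then v c else \<phi> K)" for c
  have "(\<Sum>c<M. w c) = (\<Sum>c<M'. w c) + (\<Sum>c=M'..<M' + m K. w c)"
    unfolding M(1) by (simp add: lessThan_atLeast0 sum.atLeastLessThan_concat)
  also have "\<dots> = (\<Sum>k<Suc K. real (m k) * \<phi> k)"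
    using v(2) by (simp add: w_def)
  finally have sum: "(\<Sum>c<M. w c) = (\<Sum>k<Suc K. real (m k) * \<phi> k)" .
  have "card {c. c < M \<and> s < w c} \<le> (\<Sum>k<Suc K. if s < \<phi> k then m k else 0)" if s: "0 \<le> s" for s
  proof -
    have "{c. c < M \<and> s < w c} \<subseteq> {c. c < M' \<and> s < v c} \<union> (if s < \<phi> K then {M'..<M' + m K} else {})"
      by (auto simp: w_def M(1) split: if_splits)
    then have "card {c. c < M \<and> s < w c} \<le>
        card ({c. c < M' \<and> s < v c} \<union> (if s < \<phi> K then {M'..<M' + m K} else {}))"
      by (intro card_mono) auto
    also have "\<dots> \<le> card {c. c < M' \<and> s < v c} + (if s < \<phi> K then m K else 0)"
      by (rule order_trans[OF card_Un_le]) auto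
    also have "\<dots> \<le> (\<Sum>k<Suc K. if s < \<phi> k then m k else 0)"
      using v(3)[rule_format, OF s] by simp
    finally show ?thesis .
  qed
  moreover have "\<forall>c. 0 \<le> w c" using v(1) assms(2) by (simp add: w_def)
  ultimately show ?case using sum by (intro exI[of _ w]) simp
qed

lemma sum_atMost_rev:
  fixes f :: "nat \<Rightarrow> 'a::comm_monoid_add"
  shows "(\<Sum>k\<le>N. f (N - k)) = (\<Sum>k\<le>N. f k)"
  using sum.atLeastAtMost_rev[of f 0 N] by (simp add: atMost_atLeast0)

lemma sum_powers_of_two: "(\<Sum>k\<le>N. 2 ^ k) = (2 ^ (N + 1) - 1 :: real)"
  by (induction N) auto

lemma Suc_le_power_two: "real (N + 1) \<le> 2 ^ (N + 1)"
  by (metis less_exp of_nat_le_iff of_nat_numeral of_nat_power order_less_imp_le)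

text \<open>The combinatorial heart of the proof.  Think of \<open>q l\<close> as the mass of \<open>g\<close> on the dyadic block
\<open>[2\<^sup>l, 2\<^sup>l\<^sup>+\<^sup>1)\<close> and of \<open>\<phi> i\<close> as the value of \<open>f\<close> on the block number \<open>i\<close>.  Up to the factor 4, the mass
of \<open>f\<close> on block \<open>i\<close> dominates \<open>q (i - k)\<close> summed over \<open>k \<le> N\<close>, so it can be split into portions
\<open>q (i - k)\<close>, the portion number \<open>k\<close> being sent to the block \<open>i - k + N\<close>.  The block \<open>j\<close> then
receives the same amount \<open>q (j - N)\<close> from each of the blocks \<open>j - N, ..., j\<close>, which produces
the gain \<open>N + 1\<close>.

With every block cut into \<open>2\<^sup>N\<^sup>+\<^sup>2\<close> equal cells, \<open>n j k\<close> is the number of cells of block \<open>j\<close>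
that are filled with the value \<open>\<phi> (j - k)\<close>.  The first bound says that block \<open>j\<close> has room for
them; the second that the cells filled from block \<open>i\<close>, which are \<open>2\<^sup>k\<close> times as long in block
\<open>i + k\<close>, do not exceed the length of block \<open>i\<close>.  Rounding the ideal real multiplicity
\<open>a j k\<close> up costs at most one cell per entry, and the number of cells and the factor
\<open>16\<close> leave room for that.\<close>

lemma transport_multiplicities:
  fixes q \<phi> :: "int \<Rightarrow> real"
  assumes q: "\<And>l. 0 \<le> q l" and \<phi>: "\<And>i. 0 \<le> \<phi> i"
    and dom: "\<And>i. (\<Sum>k\<le>N. q (i - int k)) \<le> 4 * 2 powi i * \<phi> i"
  obtains n :: "int \<Rightarrow> nat \<Rightarrow> nat" where
    "\<And>j. (\<Sum>k\<le>N. n j k) \<le> 2 ^ (N + 2)"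
    "\<And>i. (\<Sum>k\<le>N. n (i + int k) k * 2 ^ k) \<le> 2 ^ (N + 2)"
    "\<And>j. 2 ^ (N + 2) * (real (N + 1) / 16 * (q (j - int N) / 2 powi j)) \<le>
      (\<Sum>k\<le>N. real (n j k) * \<phi> (j - int k))"
proof
  define F where "F i = 4 * 2 powi i * \<phi> i" for i
  define a where "a j k = 2 ^ N * (q (j - int N) / F (j - int k)) / 2 ^ k" for j k
  define n where "n j k = nat \<lceil>a j k\<rceil>" for j k
  have F: "0 \<le> F i" for i using \<phi> by (simp add: F_def)
  have a: "0 \<le> a j k" for j k using F q by (simp add: a_def)
  have q_le: "q (j - int N) \<le> F (j - int k)" if "k \<le> N" for j k
  proof -
    have "q (j - int N) = q ((j - int k) - int (N - k))" using that by (simp add: algebra_simps)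
    also have "\<dots> \<le> (\<Sum>k'\<le>N. q ((j - int k) - int k'))"
      by (rule member_le_sum) (use q in auto)
    finally show ?thesis using dom[of "j - int k"] by (simp add: F_def)
  qed
  have n_le: "real (n j k) \<le> a j k + 1" and n_ge: "a j k \<le> real (n j k)" for j k
    using a[of j k] unfolding n_def by linarith+
  \<comment> \<open>The ideal multiplicities fill at most half of a block; the rounding adds \<open>N + 1\<close> cells.\<close>
  show "(\<Sum>k\<le>N. n j k) \<le> 2 ^ (N + 2)" for j
  proof -
    have a_le: "a j k \<le> 2 ^ (N - k)" if "k \<le> N" for k
    proof -
      have "q (j - int N) / F (j - int k) \<le> 1"
        using q_le[OF that, of j] F[of "j - int k"] by (auto simp: divide_le_eq)
      then have "a j k \<le> 2 ^ N * 1 / 2 ^ k"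
        unfolding a_def by (intro divide_right_mono mult_left_mono) auto
      then show ?thesis using that by (simp add: power_diff)
    qed
    have "real (\<Sum>k\<le>N. n j k) = (\<Sum>k\<le>N. real (n j k))" by simp
    also have "\<dots> \<le> (\<Sum>k\<le>N. 2 ^ (N - k) + 1)"
    proof (rule sum_mono)
      fix k assume "k \<in> {..N}"
      then show "real (n j k) \<le> 2 ^ (N - k) + 1" using n_le[of j k] a_le[of k] by simp
    qed
    also have "\<dots> = (\<Sum>k\<le>N. 2 ^ k) + real (N + 1)"
      by (simp add: sum.distrib sum_atMost_rev)
    also have "\<dots> \<le> 2 ^ (N + 2)"
      using Suc_le_power_two[of N] by (simp only: sum_powers_of_two) simp
    finally have "real (\<Sum>k\<le>N. n j k) \<le> real (2 ^ (N + 2))" by simp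
    then show ?thesis by (simp only: of_nat_le_iff)
  qed
  \<comment> \<open>The ideal multiplicities use a quarter of the length of a block, the rounding at most half.\<close>
  show "(\<Sum>k\<le>N. n (i + int k) k * 2 ^ k) \<le> 2 ^ (N + 2)" for i
  proof -
    have "(\<Sum>k\<le>N. a (i + int k) k * 2 ^ k) = 2 ^ N * ((\<Sum>k\<le>N. q (i + int k - int N)) / F i)"
      unfolding a_def sum_divide_distrib sum_distrib_left by (intro sum.cong refl) simp
    also have "(\<Sum>k\<le>N. q (i + int k - int N)) = (\<Sum>k\<le>N. q (i - int k))"
    proof -
      have "(\<Sum>k\<le>N. q (i + int k - int N)) = (\<Sum>k\<le>N. q (i - int (N - k)))"
        by (intro sum.cong refl arg_cong[of _ _ q]) auto
      then show ?thesis using sum_atMost_rev[of "\<lambda>k. q (i - int k)" N] by simp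
    qed
    also have "2 ^ N * ((\<Sum>k\<le>N. q (i - int k)) / F i) \<le> 2 ^ N * 1"
      using dom[of i] F[of i] by (intro mult_left_mono) (auto simp: F_def[symmetric] divide_le_eq)
    finally have *: "(\<Sum>k\<le>N. a (i + int k) k * 2 ^ k) \<le> 2 ^ N" by simp
    have "real (\<Sum>k\<le>N. n (i + int k) k * 2 ^ k) = (\<Sum>k\<le>N. real (n (i + int k) k) * 2 ^ k)" by simp
    also have "\<dots> \<le> (\<Sum>k\<le>N. (a (i + int k) k + 1) * 2 ^ k)"
      using n_le by (intro sum_mono mult_right_mono) auto
    also have "\<dots> = (\<Sum>k\<le>N. a (i + int k) k * 2 ^ k) + (\<Sum>k\<le>N. 2 ^ k)"
      by (simp add: algebra_simps sum.distrib)
    also have "\<dots> \<le> 2 ^ (N + 2)"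
    proof -
      have "(2::real) ^ (N + 1) = 2 * 2 ^ N" "(2::real) ^ (N + 2) = 4 * 2 ^ N" "1 \<le> (2::real) ^ N"
        by simp_all
      then show ?thesis using * unfolding sum_powers_of_two by linarith
    qed
    finally have "real (\<Sum>k\<le>N. n (i + int k) k * 2 ^ k) \<le> real (2 ^ (N + 2))" by simp
    then show ?thesis by (simp only: of_nat_le_iff)
  qed
  show "2 ^ (N + 2) * (real (N + 1) / 16 * (q (j - int N) / 2 powi j)) \<le>
      (\<Sum>k\<le>N. real (n j k) * \<phi> (j - int k))" for j
  proof -
    have "2 ^ N / 4 * (q (j - int N) / 2 powi j) \<le> real (n j k) * \<phi> (j - int k)" if k: "k \<le> N" for k
    proof (cases "\<phi> (j - int k) = 0")
      case True
      then have "q (j - int N) = 0" using q_le[OF k, of j] q[of "j - int N"] by (simp add: F_def)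
      then show ?thesis using True by simp
    next
      case False
      have "2 powi j = (2 powi (j - int k) * 2 ^ k :: real)"
        by (simp add: power_int_diff)
      then have "2 ^ N / 4 * (q (j - int N) / 2 powi j) = a j k * \<phi> (j - int k)"
        using False by (simp add: a_def F_def field_simps)
      also have "\<dots> \<le> real (n j k) * \<phi> (j - int k)"
        using n_ge \<phi> by (intro mult_right_mono) auto
      finally show ?thesis .
    qed
    then have "(\<Sum>k\<le>N. 2 ^ N / 4 * (q (j - int N) / 2 powi j)) \<le> (\<Sum>k\<le>N. real (n j k) * \<phi> (j - int k))"
      by (intro sum_mono) auto
    then show ?thesis by (simp add: field_simps)
  qed
qed

section \<open>Averages over cells of dyadic blocks\<close>

lemma sum_rotate:
  fixes f :: "nat \<Rightarrow> 'a::comm_monoid_add"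
  shows "(\<Sum>r<M. f ((c + r) mod M)) = (\<Sum>r<M. f r)"
proof (rule sum.reindex_bij_betw)
  have inj: "inj_on (\<lambda>r. (c + r) mod M) {..<M}"
  proof (rule inj_onI)
    have le: "s \<le> r" if "s < M" "(c + r) mod M = (c + s) mod M" for r s
    proof (rule ccontr)
      assume "\<not> s \<le> r"
      then have "M dvd s - r" using mod_eq_dvd_iff_nat[of "c + r" "c + s" M] that(2) by simp
      then show False using \<open>\<not> s \<le> r\<close> that(1) by (auto dest: dvd_imp_le)
    qed
    fix r s assume "r \<in> {..<M}" "s \<in> {..<M}" "(c + r) mod M = (c + s) mod M"
    then show "r = s" using le[of s r] le[of r s] by simp
  qed
  show "bij_betw (\<lambda>r. (c + r) mod M) {..<M} {..<M}"
    unfolding bij_betw_def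
  proof (intro conjI inj endo_inj_surj)
    show "(\<lambda>r. (c + r) mod M) ` {..<M} \<subseteq> {..<M}"
      using gr_zeroI by (force intro: mod_less_divisor)
  qed auto
qed

text \<open>The block of \<open>t\<close> is the \<open>j\<close> with \<open>2\<^sup>j \<le> t < 2\<^sup>j\<^sup>+\<^sup>1\<close>, and the cell of \<open>t\<close> is the number of the
piece containing \<open>t\<close> when this block is cut into \<open>M\<close> equal pieces.\<close>

definition dyadic_block :: "real \<Rightarrow> int" where
  "dyadic_block t = \<lfloor>log 2 t\<rfloor>"

definition dyadic_cell :: "nat \<Rightarrow> real \<Rightarrow> nat" where
  "dyadic_cell M t = nat \<lfloor>real M * (t / 2 powi dyadic_block t - 1)\<rfloor>"

lemma dyadic_block_iff:
  assumes "0 < t"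
  shows "dyadic_block t = j \<longleftrightarrow> 2 powi j \<le> t \<and> t < 2 powi (j + 1)"
proof -
  have *: "2 powi i = (2::real) powr real_of_int i" for i
    by (simp add: powr_real_of_int' )
  show ?thesis
    using assms unfolding dyadic_block_def floor_eq_iff *
    by (simp add: le_log_iff log_less_iff)
qed

lemma dyadic_block_bounds:
  assumes "0 < t"
  shows "2 powi dyadic_block t \<le> t" "t < 2 powi (dyadic_block t + 1)"
  using dyadic_block_iff[OF assms, of "dyadic_block t"] by auto

lemma dyadic_cell_less:
  assumes "0 < t" "0 < M"
  shows "dyadic_cell M t < M"
proof -
  have "t / 2 powi dyadic_block t < 2"
    using dyadic_block_bounds(2)[OF assms(1)] by (simp add: power_int_add divide_less_eq mult.commute)
  then have "real M * (t / 2 powi dyadic_block t - 1) < real M * 1"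
    using assms by (intro mult_strict_left_mono) auto
  then have "\<lfloor>real M * (t / 2 powi dyadic_block t - 1)\<rfloor> < int M"
    by (simp add: floor_less_iff)
  then show ?thesis using assms unfolding dyadic_cell_def by linarith
qed

lemma dyadic_cell_eq:
  assumes M: "0 < M" and c: "c < M"
  shows "{t \<in> {0<..}. dyadic_block t = j \<and> dyadic_cell M t = c} =
    {2 powi j * (1 + real c / real M)..<2 powi j * (1 + real (c + 1) / real M)}" (is "?L = ?R")
proof (intro equalityI subsetI)
  fix t assume "t \<in> ?L"
  then have t: "0 < t" "dyadic_block t = j" "dyadic_cell M t = c" by auto
  have "0 \<le> real M * (t / 2 powi j - 1)"
    using dyadic_block_bounds(1)[OF t(1)] t(2) by (simp add: le_divide_eq)
  then have "real c \<le> real M * (t / 2 powi j - 1)" "real M * (t / 2 powi j - 1) < real c + 1"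
    using t(3) unfolding dyadic_cell_def t(2) by linarith+
  then show "t \<in> ?R" using M by (auto simp: field_simps)
next
  fix t assume t: "t \<in> ?R"
  have p: "0 < (2::real) powi j" by simp
  have "2 powi j * 1 \<le> 2 powi j * (1 + real c / real M)" by (intro mult_left_mono) auto
  then have lo: "2 powi j \<le> t" using t by (simp only: atLeastLessThan_iff mult_1_right) linarith
  have "2 powi j * (1 + real (c + 1) / real M) \<le> 2 powi j * 2"
    using M c by (intro mult_left_mono) (auto simp: divide_le_eq)
  then have "t < 2 powi j * 2" using t by (simp only: atLeastLessThan_iff) linarith
  then have hi: "t < 2 powi (j + 1)" by (simp add: power_int_add)
  have t0: "0 < t" using p lo by linarith
  then have block: "dyadic_block t = j" using dyadic_block_iff lo hi by blast
  have "real c \<le> real M * (t / 2 powi j - 1)" "real M * (t / 2 powi j - 1) < real c + 1"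
    using t M by (auto simp: field_simps)
  then have "\<lfloor>real M * (t / 2 powi j - 1)\<rfloor> = int c"
    by (intro floor_unique) auto
  then show "t \<in> ?L" using t0 block by (simp add: dyadic_cell_def)
qed

lemma distribution_on_cells:
  assumes M: "0 < M"
  shows "{t \<in> {0<..}. P (dyadic_block t) (dyadic_cell M t)} \<in> sets half_line" (is "?S \<in> _")
    and "emeasure half_line {t \<in> {0<..}. P (dyadic_block t) (dyadic_cell M t)} =
      (\<integral>\<^sup>+j. ennreal (2 powi j / real M * real (card {c. c < M \<and> P j c})) \<partial>count_space UNIV)"
proof -
  define K where "K j c = {t \<in> {0<..}. dyadic_block t = j \<and> dyadic_cell M t = c}" for j c
  define X where "X j = (\<Union>c\<in>{c. c < M \<and> P j c}. K j c)" for j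
  have S: "?S = (\<Union>j. X j)"
    using dyadic_cell_less[OF _ M] by (auto simp: X_def K_def)
  have K: "K j c \<in> sets half_line" "emeasure half_line (K j c) = ennreal (2 powi j / real M)"
    if c: "c < M" for j c
  proof -
    have eq: "K j c = {2 powi j * (1 + real c / real M)..<2 powi j * (1 + real (c + 1) / real M)}"
      unfolding K_def by (rule dyadic_cell_eq[OF M c])
    show "K j c \<in> sets half_line"
      by (rule half_line_borelI) (simp add: eq, auto simp: K_def)
    have "emeasure half_line (K j c) = emeasure lebesgue (K j c)"
      by (rule emeasure_half_line) (auto simp: K_def)
    also have "\<dots> = ennreal (2 powi j * (1 + real (c + 1) / real M) - 2 powi j * (1 + real c / real M))"
      unfolding eq by (simp add: divide_right_mono)
    also have "2 powi j * (1 + real (c + 1) / real M) - 2 powi j * (1 + real c / real M) = 2 powi j / real M"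
      by (simp add: field_simps add_divide_distrib)
    finally show "emeasure half_line (K j c) = ennreal (2 powi j / real M)" .
  qed
  have X: "X j \<in> sets half_line" for j
    unfolding X_def using K by (intro sets.finite_UN) auto
  have X_measure: "emeasure half_line (X j) = ennreal (2 powi j / real M * real (card {c. c < M \<and> P j c}))" for j
  proof -
    have "emeasure half_line (X j) = (\<Sum>c\<in>{c. c < M \<and> P j c}. emeasure half_line (K j c))"
      unfolding X_def using K by (intro sum_emeasure[symmetric]) (auto simp: disjoint_family_on_def K_def)
    also have "\<dots> = (\<Sum>c\<in>{c. c < M \<and> P j c}. ennreal (2 powi j / real M))"
      using K by (intro sum.cong) auto
    also have "\<dots> = ennreal (\<Sum>c\<in>{c. c < M \<and> P j c}. 2 powi j / real M)"
      by (rule sum_ennreal) auto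
    finally show ?thesis by (simp add: mult.commute)
  qed
  show "?S \<in> sets half_line"
    unfolding S using X by (intro sets.countable_UN'') auto
  have "emeasure half_line ?S = (\<integral>\<^sup>+j. emeasure half_line (X j) \<partial>count_space UNIV)"
    unfolding S using X by (intro emeasure_UN_countable) (auto simp: disjoint_family_on_def X_def K_def)
  then show "emeasure half_line ?S =
      (\<integral>\<^sup>+j. ennreal (2 powi j / real M * real (card {c. c < M \<and> P j c})) \<partial>count_space UNIV)"
    unfolding X_measure .
qed

text \<open>Exchanges summation by target block \<open>j\<close> with summation by source block \<open>i = j - k\<close>.\<close>

lemma nn_integral_shifted_diagonals:
  fixes u :: "int \<Rightarrow> nat \<Rightarrow> real"
  assumes u: "\<And>j k. 0 \<le> u j k"
  shows "(\<integral>\<^sup>+j. ennreal (\<Sum>k\<le>N. u j k) \<partial>count_space UNIV) =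
    (\<integral>\<^sup>+i. ennreal (\<Sum>k\<le>N. u (i + int k) k) \<partial>count_space UNIV)"
proof -
  have "(\<integral>\<^sup>+j. ennreal (\<Sum>k\<le>N. u j k) \<partial>count_space UNIV) =
      (\<integral>\<^sup>+j. (\<Sum>k\<le>N. ennreal (u j k)) \<partial>count_space UNIV)"
    using u by (simp add: sum_ennreal)
  also have "\<dots> = (\<Sum>k\<le>N. \<integral>\<^sup>+j. ennreal (u j k) \<partial>count_space UNIV)"
    by (rule nn_integral_sum) simp
  also have "\<dots> = (\<Sum>k\<le>N. \<integral>\<^sup>+i. ennreal (u (i + int k) k) \<partial>count_space UNIV)"
  proof (rule sum.cong)
    fix k
    have "bij_betw (\<lambda>i. i + int k) UNIV UNIV"
      by (rule bij_betwI[of _ _ _ "\<lambda>i. i - int k"]) auto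
    then show "(\<integral>\<^sup>+j. ennreal (u j k) \<partial>count_space UNIV) = (\<integral>\<^sup>+i. ennreal (u (i + int k) k) \<partial>count_space UNIV)"
      by (rule nn_integral_bij_count_space[symmetric])
  qed simp
  also have "\<dots> = (\<integral>\<^sup>+i. (\<Sum>k\<le>N. ennreal (u (i + int k) k)) \<partial>count_space UNIV)"
    by (rule nn_integral_sum[symmetric]) simp
  also have "\<dots> = (\<integral>\<^sup>+i. ennreal (\<Sum>k\<le>N. u (i + int k) k) \<partial>count_space UNIV)"
    using u by (simp add: sum_ennreal)
  finally show ?thesis .
qed

context symmetric_banach_space
begin

text \<open>Let \<open>v j c\<close> be the value on cell \<open>c\<close> of block \<open>j\<close>.  The hypotheses say that the values larger
than \<open>s\<close> occupy no more length than \<open>f\<close> spends above \<open>s\<close>, so the resulting step function has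
norm at most \<open>\<parallel>f\<parallel>\<close>.  Rotating the cells within every block leaves the distribution
unchanged, and the mean over the \<open>M\<close> rotations replaces each value by the average over its
block.\<close>

lemma cell_average_mem:
  fixes v :: "int \<Rightarrow> nat \<Rightarrow> real" and n :: "int \<Rightarrow> nat \<Rightarrow> nat"
  assumes f: "f \<in> E" and M: "0 < M"
    and v_nonneg: "\<And>j c. 0 \<le> v j c"
    and f_ge: "\<And>t. 0 < t \<Longrightarrow> \<phi> (dyadic_block t) \<le> f t"
    and count: "\<And>j s. 0 \<le> s \<Longrightarrow>
      card {c. c < M \<and> s < v j c} \<le> (\<Sum>k\<le>N. if s < \<phi> (j - int k) then n j k else 0)"
    and col: "\<And>i. (\<Sum>k\<le>N. n (i + int k) k * 2 ^ k) \<le> M"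
  shows "(\<lambda>t. (\<Sum>c<M. v (dyadic_block t) c) / real M) \<in> E"
    and "nrm (\<lambda>t. (\<Sum>c<M. v (dyadic_block t) c) / real M) \<le> nrm f"
proof -
  have budget: "(\<integral>\<^sup>+j. ennreal (2 powi j / real M * real (card {c. c < M \<and> s < v j c})) \<partial>count_space UNIV)
      \<le> distribution f s" if s: "0 \<le> s" for s
  proof -
    define u where "u j k = (if s < \<phi> (j - int k) then 2 powi j / real M * real (n j k) else 0)" for j k
    have "(\<integral>\<^sup>+j. ennreal (2 powi j / real M * real (card {c. c < M \<and> s < v j c})) \<partial>count_space UNIV)
        \<le> (\<integral>\<^sup>+j. ennreal (\<Sum>k\<le>N. u j k) \<partial>count_space UNIV)"
    proof (intro nn_integral_mono ennreal_leI)
      fix j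
      have "real (card {c. c < M \<and> s < v j c}) \<le> real (\<Sum>k\<le>N. if s < \<phi> (j - int k) then n j k else 0)"
        using count[OF s] by (intro of_nat_mono)
      then have "2 powi j / real M * real (card {c. c < M \<and> s < v j c}) \<le>
          2 powi j / real M * real (\<Sum>k\<le>N. if s < \<phi> (j - int k) then n j k else 0)"
        by (intro mult_left_mono) auto
      also have "\<dots> = (\<Sum>k\<le>N. u j k)"
        unfolding u_def of_nat_sum sum_distrib_left by (intro sum.cong) auto
      finally show "2 powi j / real M * real (card {c. c < M \<and> s < v j c}) \<le> (\<Sum>k\<le>N. u j k)" .
    qed
    also have "\<dots> = (\<integral>\<^sup>+i. ennreal (\<Sum>k\<le>N. u (i + int k) k) \<partial>count_space UNIV)"
      by (rule nn_integral_shifted_diagonals) (simp add: u_def)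
    also have "\<dots> \<le> (\<integral>\<^sup>+i. ennreal (2 powi i / real M * real (card {c. c < M \<and> s < \<phi> i})) \<partial>count_space UNIV)"
    proof (intro nn_integral_mono ennreal_leI)
      fix i
      show "(\<Sum>k\<le>N. u (i + int k) k) \<le> 2 powi i / real M * real (card {c. c < M \<and> s < \<phi> i})"
      proof (cases "s < \<phi> i")
        case True
        have "(\<Sum>k\<le>N. u (i + int k) k) = 2 powi i / real M * real (\<Sum>k\<le>N. n (i + int k) k * 2 ^ k)"
          unfolding u_def of_nat_sum sum_distrib_left using True
          by (intro sum.cong) (auto simp: power_int_add)
        also have "\<dots> \<le> 2 powi i / real M * real M"
          using col[of i] by (intro mult_left_mono of_nat_mono) auto
        finally show ?thesis using True by simp
      qed (simp add: u_def)
    qed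
    also have "\<dots> = emeasure half_line {t \<in> {0<..}. s < \<phi> (dyadic_block t)}"
      by (rule distribution_on_cells(2)[OF M, of "\<lambda>j c. s < \<phi> j", symmetric])
    also have "\<dots> \<le> distribution f s"
      unfolding distribution_def
    proof (rule emeasure_mono)
      show "{t \<in> {0<..}. s < \<phi> (dyadic_block t)} \<subseteq> {t \<in> {0<..}. s < \<bar>f t\<bar>}"
        using f_ge by (force intro: less_le_trans)
    qed (rule level_set_measurable[OF mem_measurable[OF f]])
    finally show ?thesis .
  qed
  define h where "h r t = v (dyadic_block t) ((dyadic_cell M t + r) mod M)" for r t
  have h: "h r \<in> E" "nrm (h r) \<le> nrm f" for r
  proof -
    have meas: "h r \<in> borel_measurable half_line"
      unfolding h_def by (rule half_line_measurableI) (rule distribution_on_cells(1)[OF M])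
    have dist: "distribution (h r) s \<le> distribution f s" if s: "0 \<le> s" for s
    proof -
      have card_eq: "card {c. c < M \<and> s < v j ((c + r) mod M)} = card {c. c < M \<and> s < v j c}" for j
      proof -
        have as_sum: "card {c. c < M \<and> P c} = (\<Sum>c<M. if P c then 1 else 0)" for P
          by (simp add: sum.If_cases lessThan_def Collect_conj_eq)
        show ?thesis unfolding as_sum
          using sum_rotate[of "\<lambda>c. if s < v j c then 1 else 0 :: nat" r M] by (simp add: add.commute)
      qed
      have "distribution (h r) s = emeasure half_line {t \<in> {0<..}. s < v (dyadic_block t) ((dyadic_cell M t + r) mod M)}"
        unfolding distribution_def h_def using v_nonneg by (simp only: abs_of_nonneg)
      also have "\<dots> = (\<integral>\<^sup>+j. ennreal (2 powi j / real M * real (card {c. c < M \<and> s < v j ((c + r) mod M)})) \<partial>count_space UNIV)"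
        by (rule distribution_on_cells(2)[OF M])
      also have "\<dots> \<le> distribution f s"
        unfolding card_eq by (rule budget[OF s])
      finally show ?thesis .
    qed
    show "h r \<in> E" "nrm (h r) \<le> nrm f"
      by (rule distribution_le_mem[OF f meas dist], assumption)+
  qed
  have avg: "(\<Sum>c<M. v (dyadic_block t) c) / real M = (1 / real M) * (\<Sum>r<M. h r t)" for t
    unfolding h_def using sum_rotate[of "v (dyadic_block t)" "dyadic_cell M t" M] by simp
  have sum: "(\<lambda>t. \<Sum>r<M. h r t) \<in> E" "nrm (\<lambda>t. \<Sum>r<M. h r t) \<le> real M * nrm f"
  proof -
    show "(\<lambda>t. \<Sum>r<M. h r t) \<in> E" using h by (intro sum_mem) auto
    have "nrm (\<lambda>t. \<Sum>r<M. h r t) \<le> (\<Sum>r<M. nrm (h r))" using h by (intro sum_mem) auto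
    also have "\<dots> \<le> (\<Sum>r<M. nrm f)" using h by (intro sum_mono) auto
    finally show "nrm (\<lambda>t. \<Sum>r<M. h r t) \<le> real M * nrm f" by simp
  qed
  show "(\<lambda>t. (\<Sum>c<M. v (dyadic_block t) c) / real M) \<in> E"
    unfolding avg by (rule scale_mem[OF sum(1)])
  show "nrm (\<lambda>t. (\<Sum>c<M. v (dyadic_block t) c) / real M) \<le> nrm f"
    unfolding avg nrm_scale[OF sum(1)] using sum(2) M by (simp add: pos_divide_le_eq mult.commute)
qed

text \<open>The hypothesis is the discrete form of \<open>\<integral>\<^sub>0\<^sup>t g \<le> t f(t)\<close> up to a constant.  The average
over the block \<open>j\<close> of the values supplied by \<open>transport_multiplicities\<close> is at least
\<open>(N + 1) / 16\<close> times \<open>2\<^sup>-\<^sup>N g(2\<^sup>j\<^sup>-\<^sup>N)\<close>, and this dominates the averaged dilation of \<open>g\<close> there.\<close>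

lemma dilation_bound_of_dyadic_domination:
  assumes f: "f \<in> E" and f_anti: "\<And>s t. 0 < s \<Longrightarrow> s \<le> t \<Longrightarrow> f t \<le> f s" and f_nonneg: "\<And>t. 0 < t \<Longrightarrow> 0 \<le> f t"
    and g: "g \<in> borel_measurable half_line"
    and g_anti: "\<And>s t. 0 < s \<Longrightarrow> s \<le> t \<Longrightarrow> g t \<le> g s" and g_nonneg: "\<And>t. 0 < t \<Longrightarrow> 0 \<le> g t"
    and dom: "\<And>i. (\<Sum>k\<le>N. 2 powi (i - int k) * g (2 powi (i - int k))) \<le> 4 * 2 powi i * f (2 powi (i + 1))"
  shows "real (N + 1) / 16 * (nrm (dilation (2 ^ N) g) / 2 ^ N) \<le> nrm f"
proof -
  define q where "q l = 2 powi l * g (2 powi l)" for l :: int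
  define \<phi> where "\<phi> i = f (2 powi (i + 1))" for i :: int
  define M :: nat where "M = 2 ^ (N + 2)"
  have M: "0 < M" by (simp add: M_def)
  have q0: "0 \<le> q l" for l unfolding q_def by (intro mult_nonneg_nonneg g_nonneg) auto
  have \<phi>0: "0 \<le> \<phi> i" for i unfolding \<phi>_def by (intro f_nonneg) auto
  have q_dom: "(\<Sum>k\<le>N. q (i - int k)) \<le> 4 * 2 powi i * \<phi> i" for i
    unfolding q_def \<phi>_def by (rule dom)
  have M_real: "real M = 2 ^ (N + 2)" by (simp add: M_def)
  obtain n :: "int \<Rightarrow> nat \<Rightarrow> nat" where
    n: "\<And>j. (\<Sum>k\<le>N. n j k) \<le> 2 ^ (N + 2)"
    "\<And>i. (\<Sum>k\<le>N. n (i + int k) k * 2 ^ k) \<le> 2 ^ (N + 2)"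
    "\<And>j. 2 ^ (N + 2) * (real (N + 1) / 16 * (q (j - int N) / 2 powi j)) \<le>
      (\<Sum>k\<le>N. real (n j k) * \<phi> (j - int k))"
    by (rule transport_multiplicities[of q \<phi> N, OF q0 \<phi>0 q_dom], rule that)
  have row: "(\<Sum>k\<le>N. n j k) \<le> M" for j
    using n(1)[of j] by (simp only: M_def)
  have col: "(\<Sum>k\<le>N. n (i + int k) k * 2 ^ k) \<le> M" for i
    using n(2)[of i] by (simp only: M_def)
  have gain: "real M * (real (N + 1) / 16 * (q (j - int N) / 2 powi j)) \<le>
      (\<Sum>k\<le>N. real (n j k) * \<phi> (j - int k))" for j
    using n(3)[of j] by (simp only: M_real)
  have "\<exists>v. (\<forall>c. 0 \<le> v c) \<and> (\<Sum>c<M. v c) = (\<Sum>k\<le>N. real (n j k) * \<phi> (j - int k)) \<and>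
    (\<forall>s\<ge>0. card {c. c < M \<and> s < v c} \<le> (\<Sum>k\<le>N. if s < \<phi> (j - int k) then n j k else 0))" for j
    using values_from_multiplicities[of "n j" "Suc N" M "\<lambda>k. \<phi> (j - int k)"] row[of j] \<phi>0
    by (simp only: lessThan_Suc_atMost)
  then obtain v where v: "\<And>j. (\<forall>c. 0 \<le> v j c) \<and>
    (\<Sum>c<M. v j c) = (\<Sum>k\<le>N. real (n j k) * \<phi> (j - int k)) \<and>
    (\<forall>s\<ge>0. card {c. c < M \<and> s < v j c} \<le> (\<Sum>k\<le>N. if s < \<phi> (j - int k) then n j k else 0))"
    using choice[of "\<lambda>j v. (\<forall>c. 0 \<le> v c) \<and>
      (\<Sum>c<M. v c) = (\<Sum>k\<le>N. real (n j k) * \<phi> (j - int k)) \<and>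
      (\<forall>s\<ge>0. card {c. c < M \<and> s < v c} \<le> (\<Sum>k\<le>N. if s < \<phi> (j - int k) then n j k else 0))"]
    by blast
  have v_nonneg: "0 \<le> v j c" for j c using v[of j] by simp
  have v_sum: "(\<Sum>c<M. v j c) = (\<Sum>k\<le>N. real (n j k) * \<phi> (j - int k))" for j using v[of j] by simp
  have v_card: "card {c. c < M \<and> s < v j c} \<le> (\<Sum>k\<le>N. if s < \<phi> (j - int k) then n j k else 0)"
    if "0 \<le> s" for j s using v[of j] that by simp
  have f_ge: "\<phi> (dyadic_block t) \<le> f t" if "0 < t" for t
    unfolding \<phi>_def using dyadic_block_bounds(2)[OF that] that by (intro f_anti) auto
  define h where "h t = (\<Sum>c<M. v (dyadic_block t) c) / real M" for t
  have h: "h \<in> E" "nrm h \<le> nrm f"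
    unfolding h_def[abs_def] by (rule cell_average_mem[OF f M v_nonneg f_ge v_card col]; assumption)+
  define C where "C = real (N + 1) / 16 / 2 ^ N"
  have C: "0 < C" by (simp add: C_def)
  have le: "C * dilation (2 ^ N) g t \<le> h t" if t: "0 < t" for t
  proof -
    let ?j = "dyadic_block t"
    have "2 powi (?j - int N) \<le> t / 2 ^ N"
      using dyadic_block_bounds(1)[OF t] by (simp add: power_int_diff divide_right_mono)
    then have "g (t / 2 ^ N) \<le> g (2 powi (?j - int N))" by (intro g_anti) auto
    then have "C * dilation (2 ^ N) g t \<le> C * g (2 powi (?j - int N))"
      using C by (simp add: dilation_def)
    also have "\<dots> = real (N + 1) / 16 * (q (?j - int N) / 2 powi ?j)"
      by (simp add: q_def C_def power_int_diff)
    also have "\<dots> \<le> h t"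
      using gain[of ?j] M unfolding h_def v_sum by (simp add: le_divide_eq mult.commute)
    finally show ?thesis .
  qed
  have dil: "dilation (2 ^ N) g \<in> borel_measurable half_line"
    by (rule dilation_measurable[OF g]) simp
  have nn: "0 \<le> dilation (2 ^ N) g t" if "0 < t" for t
    using that unfolding dilation_def by (intro g_nonneg) simp
  have Cd: "(\<lambda>t. C * dilation (2 ^ N) g t) \<in> E" "nrm (\<lambda>t. C * dilation (2 ^ N) g t) \<le> nrm h"
  proof -
    have "(\<lambda>t. C * dilation (2 ^ N) g t) \<in> borel_measurable half_line"
      using dil by (rule borel_measurable_times[OF borel_measurable_const])
    moreover have "AE t in half_line. 0 \<le> C * dilation (2 ^ N) g t \<and> C * dilation (2 ^ N) g t \<le> h t"
      using le nn C by (intro AE_I2) auto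
    ultimately show "(\<lambda>t. C * dilation (2 ^ N) g t) \<in> E" "nrm (\<lambda>t. C * dilation (2 ^ N) g t) \<le> nrm h"
      using solid[OF h(1)] by auto
  qed
  have "dilation (2 ^ N) g \<in> E"
    using scale_mem[OF Cd(1), of "1 / C"] C by simp
  then have "nrm (\<lambda>t. C * dilation (2 ^ N) g t) = C * nrm (dilation (2 ^ N) g)"
    using nrm_scale[of "dilation (2 ^ N) g" C] C by simp
  then show ?thesis using Cd(2) h(2) by (simp add: C_def)
qed

end

section \<open>Convergence of the dilation averages\<close>

text \<open>A form of Fekete's lemma: comparing \<open>n\<close> with the next multiple of \<open>m\<close> gives
\<open>a n / n \<le> a m / m + a m / n\<close>, so the limit is the infimum of the quotients.\<close>

lemma subhomogeneous_average_convergent: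
  fixes a :: "nat \<Rightarrow> real"
  assumes nonneg: "\<And>m. 0 < m \<Longrightarrow> 0 \<le> a m"
    and mono: "\<And>m n. 0 < m \<Longrightarrow> m \<le> n \<Longrightarrow> a m \<le> a n"
    and mult: "\<And>k m. 0 < k \<Longrightarrow> 0 < m \<Longrightarrow> a (k * m) \<le> real k * a m"
  shows "convergent (\<lambda>m. 1 / real m * a m)"
proof -
  define b where "b m = 1 / real m * a m" for m
  define c where "c = Inf (b ` {0<..})"
  have bdd: "bdd_below (b ` {0<..})"
    using nonneg by (intro bdd_belowI[of _ 0]) (auto simp: b_def)
  have "b \<longlonglongrightarrow> c"
  proof (rule LIMSEQ_I)
    fix r :: real assume r: "0 < r"
    have "\<exists>z\<in>b ` {0<..}. z < c + r / 2"
      by (rule cInf_lessD) (use r in \<open>auto simp: c_def[symmetric]\<close>)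
    then obtain m where m: "0 < m" "b m < c + r / 2" by auto
    obtain n0 where n0: "2 * a m / r < real n0" using reals_Archimedean2 by blast
    have "norm (b n - c) < r" if n: "max 1 n0 \<le> n" for n
    proof -
      have n1: "0 < n" "2 * a m / r < real n" using n n0 by auto
      have "c \<le> b n" unfolding c_def using bdd n1 by (intro cInf_lower) auto
      define k where "k = n div m + 1"
      have "n \<le> k * m"
        unfolding k_def using m(1) by (metis add.commute add_mult_distrib div_mult_mod_eq le_less
            mod_less_divisor mult_1 nat_add_left_cancel_le)
      then have "a n \<le> a (k * m)" using n1 by (intro mono)
      also have "\<dots> \<le> real k * a m" using m by (intro mult) (auto simp: k_def)
      also have "\<dots> \<le> (real n / real m + 1) * a m"
      proof (rule mult_right_mono)
        have "real (n div m) \<le> real n / real m" by (rule of_nat_div_le_of_nat)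
        then show "real k \<le> real n / real m + 1" by (simp add: k_def)
      qed (rule nonneg[OF m(1)])
      finally have "b n \<le> 1 / real n * ((real n / real m + 1) * a m)"
        unfolding b_def by (intro mult_left_mono) auto
      also have "\<dots> = b m + a m / real n"
        using n1 m by (simp add: b_def field_simps)
      also have "a m / real n < r / 2"
        using n1 r by (simp add: field_simps)
      finally have "b n < c + r" using m(2) by simp
      with \<open>c \<le> b n\<close> show ?thesis by simp
    qed
    then show "\<exists>no. \<forall>n\<ge>no. norm (b n - c) < r" by blast
  qed
  then show ?thesis unfolding convergent_def b_def by blast
qed

section \<open>Spans of differences of equimeasurable functions\<close>

lemma separating_linear_functional:
  fixes S :: "(real \<Rightarrow> real) set" and x :: "real \<Rightarrow> real"
  defines "smul \<equiv> (\<lambda>c f t. c * f t :: real)"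
  assumes x: "x \<notin> module.span smul S"
  shows "\<exists>\<phi>. (\<forall>f g. \<phi> (\<lambda>t. f t + g t) = \<phi> f + \<phi> g) \<and> (\<forall>c f. \<phi> (\<lambda>t. c * f t) = c * \<phi> f) \<and>
    (\<forall>f\<in>S. \<phi> f = 0) \<and> \<phi> x = (r::real)"
proof -
  interpret vector_space_pair smul "(*) :: real \<Rightarrow> real \<Rightarrow> real"
    by unfold_locales (auto simp: smul_def fun_eq_iff algebra_simps)
  obtain B where B: "B \<subseteq> S" "vs1.independent B" "S \<subseteq> vs1.span B"
    using vs1.maximal_independent_subset[of S] by blast
  have "x \<notin> vs1.span B" using x vs1.span_mono[OF B(1)] by auto
  then have "vs1.independent (insert x B)" using B(2) by (rule vs1.independent_insertI)
  from linear_independent_extend[OF this, of "\<lambda>b. if b = x then r else 0"]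
  obtain \<phi> where lin: "Vector_Spaces.linear smul (*) \<phi>"
    and \<phi>: "\<forall>b\<in>insert x B. \<phi> b = (if b = x then r else 0)" by blast
  have "x \<notin> B" using \<open>x \<notin> vs1.span B\<close> vs1.span_base by blast
  then have "\<phi> b = 0" if "b \<in> B" for b using \<phi> that by auto
  then have "\<phi> f = 0" if "f \<in> S" for f
    using linear_eq_0_on_span[OF lin, of B f] B(3) that by blast
  moreover have "\<phi> (\<lambda>t. f t + g t) = \<phi> f + \<phi> g" for f g
    using linear_add[OF lin, of f g] by (simp add: plus_fun_def)
  moreover have "\<phi> (\<lambda>t. c * f t) = c * \<phi> f" for c f
    using linear_scale[OF lin, of c f] by (simp add: smul_def)
  ultimately show ?thesis using \<phi> by (intro exI[of _ \<phi>]) auto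
qed

lemma distribution_cmult:
  assumes "0 < c"
  shows "distribution (\<lambda>t. c * x t) s = distribution x (s / c)"
proof -
  have "{u \<in> {0<..}. s < \<bar>c * x u\<bar>} = {u \<in> {0<..}. s / c < \<bar>x u\<bar>}"
    using assms by (auto simp: abs_mult field_simps)
  then show ?thesis unfolding distribution_def by (rule arg_cong)
qed

text \<open>On the block \<open>[2\<^sup>l\<^sup>-\<^sup>1, 2\<^sup>l)\<close>, whose length is \<open>2\<^sup>l / 2\<close>, the decreasing function \<open>g\<close> is at least
\<open>g(2\<^sup>l)\<close>.\<close>

lemma sum_le_integral_antimono:
  fixes g :: "real \<Rightarrow> real"
  assumes int: "integrable half_line (\<lambda>t. g t * indicator {0<..<2 powi (i + 1)} t)"
    and g_anti: "\<And>s t. 0 < s \<Longrightarrow> s \<le> t \<Longrightarrow> g t \<le> g s" and g_nonneg: "\<And>t. 0 < t \<Longrightarrow> 0 \<le> g t"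
  shows "(\<Sum>k\<le>N. 2 powi (i - int k) * g (2 powi (i - int k))) \<le>
    2 * (\<integral>t. g t * indicator {0<..<2 powi (i + 1)} t \<partial>half_line)"
proof -
  define J where "J k = {t \<in> {0<..}. dyadic_block t = i - int k - 1}" for k
  have J_eq: "J k = {2 powi (i - int k - 1)..<2 powi (i - int k)}" for k
  proof -
    have "t \<in> J k \<longleftrightarrow> t \<in> {2 powi (i - int k - 1)..<2 powi (i - int k)}" for t
      using dyadic_block_iff[of t "i - int k - 1"]
        less_le_trans[of 0 "2 powi (i - int k - 1)" t] by (auto simp: J_def)
    then show ?thesis by blast
  qed
  have J_sets: "J k \<in> sets half_line" for k
    by (rule half_line_borelI) (simp add: J_eq, auto simp: J_def)
  have half: "2 powi l - 2 powi (l - 1) = (2 powi l / 2 :: real)" for l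
    by (simp add: power_int_diff)
  have J_emeasure: "emeasure half_line (J k) = ennreal (2 powi (i - int k) / 2)" for k
  proof -
    have "emeasure half_line (J k) = emeasure lebesgue (J k)"
      by (rule emeasure_half_line) (auto simp: J_def)
    also have "\<dots> = ennreal (2 powi (i - int k) - 2 powi (i - int k - 1))"
      unfolding J_eq by (simp add: power_int_increasing)
    finally show ?thesis unfolding half .
  qed
  have J_int: "integrable half_line (\<lambda>t. g (2 powi (i - int k)) * indicator (J k) t)" for k
    using J_sets J_emeasure by (intro integrable_mult_right integrable_real_indicator) auto
  have "(\<Sum>k\<le>N. 2 powi (i - int k) * g (2 powi (i - int k))) =
      2 * (\<Sum>k\<le>N. \<integral>t. g (2 powi (i - int k)) * indicator (J k) t \<partial>half_line)"
    unfolding sum_distrib_left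
  proof (intro sum.cong refl)
    fix k
    have "J k \<inter> {0<..} = J k" by (auto simp: J_def)
    then show "2 powi (i - int k) * g (2 powi (i - int k)) =
        2 * (\<integral>t. g (2 powi (i - int k)) * indicator (J k) t \<partial>half_line)"
      using J_sets by (simp add: J_emeasure measure_def)
  qed
  also have "(\<Sum>k\<le>N. \<integral>t. g (2 powi (i - int k)) * indicator (J k) t \<partial>half_line) =
      (\<integral>t. (\<Sum>k\<le>N. g (2 powi (i - int k)) * indicator (J k) t) \<partial>half_line)"
    using J_int by (intro Bochner_Integration.integral_sum[symmetric])
  also have "\<dots> \<le> (\<integral>t. g t * indicator {0<..<2 powi (i + 1)} t \<partial>half_line)"
  proof (rule integral_mono[OF Bochner_Integration.integrable_sum[OF J_int] int])
    fix t :: real assume "t \<in> space half_line"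
    then have t: "0 < t" by simp
    show "(\<Sum>k\<le>N. g (2 powi (i - int k)) * indicator (J k) t) \<le> g t * indicator {0<..<2 powi (i + 1)} t"
    proof (cases "\<exists>k\<le>N. t \<in> J k")
      case True
      then obtain k where k: "k \<le> N" "t \<in> J k" by blast
      have "(\<Sum>k'\<le>N. g (2 powi (i - int k')) * indicator (J k') t) =
          (\<Sum>k'\<in>{k}. g (2 powi (i - int k')) * indicator (J k') t)"
        by (rule sum.mono_neutral_right) (use k in \<open>auto simp: J_def indicator_def\<close>)
      also have "\<dots> = g (2 powi (i - int k))" using k by simp
      also have "\<dots> \<le> g t" using k(2) t by (intro g_anti) (auto simp: J_eq)
      also have "t < 2 powi (i + 1)"
      proof -
        have "t < 2 powi (i - int k)" using k(2) by (auto simp: J_eq)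
        also have "\<dots> \<le> 2 powi (i + 1)" by (intro power_int_increasing) auto
        finally show ?thesis .
      qed
      then have "g t = g t * indicator {0<..<2 powi (i + 1)} t" using t by simp
      finally show ?thesis .
    next
      case False
      then have "(\<Sum>k\<le>N. g (2 powi (i - int k)) * indicator (J k) t) = 0"
        by (intro sum.neutral) auto
      then show ?thesis using g_nonneg[OF t] by (simp add: indicator_def)
    qed
  qed
  finally show ?thesis by simp
qed

context symmetric_banach_space
begin

text \<open>Stated through distribution functions, which on \<open>E\<close> amounts to equimeasurability and scales
without referring to infima.\<close>

definition rearranged_pair :: "(real \<Rightarrow> real) \<Rightarrow> (real \<Rightarrow> real) \<Rightarrow> bool" where
  "rearranged_pair u v \<longleftrightarrow> u \<in> E \<and> v \<in> E \<and> (AE t in half_line. 0 \<le> u t) \<and>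
     (AE t in half_line. 0 \<le> v t) \<and> (\<forall>s\<ge>0. distribution u s = distribution v s)"

definition rearrangement_differences :: "(real \<Rightarrow> real) set" where
  "rearrangement_differences = {\<lambda>t. u t - v t |u v. rearranged_pair u v}"

lemma rearranged_pair_sym: "rearranged_pair u v \<Longrightarrow> rearranged_pair v u"
  by (auto simp: rearranged_pair_def)

lemma rearranged_pair_scale:
  assumes "rearranged_pair u v" "0 \<le> c"
  shows "rearranged_pair (\<lambda>t. c * u t) (\<lambda>t. c * v t)"
proof -
  have "AE t in half_line. 0 \<le> c * u t" "AE t in half_line. 0 \<le> c * v t"
    using assms unfolding rearranged_pair_def by (auto intro: eventually_mono[OF _ mult_nonneg_nonneg])
  moreover have "\<forall>s\<ge>0. distribution (\<lambda>t. c * u t) s = distribution (\<lambda>t. c * v t) s"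
  proof (cases "c = 0")
    case False
    then have c: "0 < c" using assms by simp
    then show ?thesis using assms by (auto simp: distribution_cmult[OF c] rearranged_pair_def)
  qed simp
  ultimately show ?thesis using assms scale_mem by (auto simp: rearranged_pair_def)
qed

text \<open>Scalars are absorbed into the pairs, a negative one by exchanging the two members.\<close>

lemma span_rearrangement_differences:
  assumes "z \<in> module.span (\<lambda>c f t. c * f t) rearrangement_differences"
  shows "\<exists>(n::nat) u v. (\<forall>i<n. rearranged_pair (u i) (v i)) \<and> (\<forall>t. z t = (\<Sum>i<n. u i t - v i t))"
proof -
  interpret vector_space "\<lambda>c f t. c * f t :: real"
    by unfold_locales (auto simp: fun_eq_iff algebra_simps)
  show ?thesis
    using assms
  proof (induction rule: span_induct_alt)
    case base
    show ?case by (intro exI[of _ 0]) auto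
  next
    case (step c x y)
    obtain u0 v0 where x: "x = (\<lambda>t. u0 t - v0 t)" and uv0: "rearranged_pair u0 v0"
      using step(1) unfolding rearrangement_differences_def by blast
    obtain u1 v1 where uv1: "rearranged_pair u1 v1" and cx: "\<And>t. c * x t = u1 t - v1 t"
    proof (cases "0 \<le> c")
      case True
      show ?thesis
        by (rule that[OF rearranged_pair_scale[OF uv0 True]]) (simp add: x algebra_simps)
    next
      case False
      then have "0 \<le> - c" by simp
      show ?thesis
        by (rule that[OF rearranged_pair_scale[OF rearranged_pair_sym[OF uv0] \<open>0 \<le> - c\<close>]])
           (simp add: x algebra_simps)
    qed
    obtain n :: nat and u v where uv: "\<forall>i<n. rearranged_pair (u i) (v i)"
      and y: "\<forall>t. y t = (\<Sum>i<n. u i t - v i t)" using step(2) by blast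
    define u' where "u' i = (if i < n then u i else u1)" for i
    define v' where "v' i = (if i < n then v i else v1)" for i
    have "\<forall>i<Suc n. rearranged_pair (u' i) (v' i)"
      using uv uv1 by (auto simp: u'_def v'_def)
    moreover have "((\<lambda>t. c * x t) + y) t = (\<Sum>i<Suc n. u' i t - v' i t)" for t
      using y cx by (simp add: u'_def v'_def)
    ultimately show ?case by blast
  qed
qed

lemma integral_rearranged_above_level:
  assumes "rearranged_pair u v" and s: "0 \<le> s" and fin: "distribution u s < \<infinity>"
  shows "(\<integral>t. \<bar>u t\<bar> * indicator {r \<in> {0<..}. s < \<bar>u r\<bar>} t \<partial>half_line) =
    (\<integral>t. \<bar>v t\<bar> * indicator {r \<in> {0<..}. s < \<bar>v r\<bar>} t \<partial>half_line)"
proof -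
  have u: "u \<in> E" and v: "v \<in> E" and eq: "\<And>s. 0 \<le> s \<Longrightarrow> distribution u s = distribution v s"
    using assms(1) by (auto simp: rearranged_pair_def)
  have *: "(\<integral>t. \<bar>w t\<bar> * indicator {r \<in> {0<..}. s < \<bar>w r\<bar>} t \<partial>half_line) =
      enn2real (\<integral>\<^sup>+s'. indicator {0..} s' * distribution w (max s' s) \<partial>lborel)"
    if w: "w \<in> E" and "distribution w s < \<infinity>" for w
    unfolding nn_integral_above_level[OF mem_measurable[OF w] s, symmetric]
    using L1_plus_Linf_abs_integrable_above_level[OF mem_L1_plus_Linf[OF w] that(2)]
    by (intro integral_eq_nn_integral) auto
  have "(\<integral>\<^sup>+s'. indicator {0..} s' * distribution u (max s' s) \<partial>lborel) =
      (\<integral>\<^sup>+s'. indicator {0..} s' * distribution v (max s' s) \<partial>lborel)"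
    by (intro nn_integral_cong) (use s in \<open>auto simp: eq max_def indicator_def\<close>)
  then show ?thesis using *[OF u fin] *[OF v] fin eq[OF s] by simp
qed

text \<open>Let \<open>\<tau>\<^sub>i\<close> be the common value of \<open>u\<^sub>i\<^sup>*\<close> and \<open>v\<^sub>i\<^sup>*\<close> at \<open>b\<close>, and let \<open>U\<^sub>i\<close>, \<open>V\<^sub>i\<close> be the sets, of
measure at most \<open>b\<close>, on which \<open>u\<^sub>i\<close> and \<open>v\<^sub>i\<close> exceed \<open>\<tau>\<^sub>i\<close>.  Since \<open>g \<ge> 0\<close>, the integral may
only grow when \<open>(0,b)\<close> is enlarged to \<open>A = (0,b) \<union> \<Union>V\<^sub>i\<close>.  On \<open>A\<close> one has
\<open>u\<^sub>i \<le> u\<^sub>i \<cdot> 1[U\<^sub>i] + \<tau>\<^sub>i\<close> and \<open>v\<^sub>i \<ge> v\<^sub>i \<cdot> 1[V\<^sub>i]\<close>; the integrals of \<open>u\<^sub>i \<cdot> 1[U\<^sub>i]\<close> and \<open>v\<^sub>i \<cdot> 1[V\<^sub>i]\<close> are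
equal and finite, and \<open>\<tau>\<^sub>i\<close> times the measure of \<open>A\<close> remains.\<close>

lemma integral_bound_of_rearrangement_differences:
  assumes g: "g \<in> E" "\<And>t. 0 < t \<Longrightarrow> 0 \<le> g t"
    and uv: "\<And>i. i < n \<Longrightarrow> rearranged_pair (u i) (v i)"
    and g_eq: "\<And>t. 0 < t \<Longrightarrow> g t = (\<Sum>i<n. u i t - v i t)"
    and b: "0 < b"
  shows "(\<integral>t. g t * indicator {0<..<b} t \<partial>half_line) \<le> real (n + 1) * b * (\<Sum>i<n. decr_rearr (u i) b)"
proof -
  define \<tau> where "\<tau> i = decr_rearr (u i) b" for i
  define U where "U i = {t \<in> {0<..}. \<tau> i < \<bar>u i t\<bar>}" for i
  define V where "V i = {t \<in> {0<..}. \<tau> i < \<bar>v i t\<bar>}" for i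
  define A where "A = {0<..<b} \<union> (\<Union>i<n. V i)"
  have uE: "u i \<in> E" and vE: "v i \<in> E" if "i < n" for i
    using uv[OF that] by (auto simp: rearranged_pair_def)
  have \<tau>: "0 \<le> \<tau> i" if "i < n" for i
    unfolding \<tau>_def by (rule decr_rearr_nonneg[OF mem_L1_plus_Linf[OF uE[OF that]] b])
  have du: "distribution (u i) (\<tau> i) \<le> ennreal b" if "i < n" for i
    unfolding \<tau>_def by (rule distribution_decr_rearr_le[OF mem_L1_plus_Linf[OF uE[OF that]] b])
  have dv: "distribution (v i) (\<tau> i) \<le> ennreal b" if "i < n" for i
    using du[OF that] uv[OF that] \<tau>[OF that] by (auto simp: rearranged_pair_def)
  have V: "V i \<in> sets half_line" "emeasure half_line (V i) \<le> ennreal b" if "i < n" for i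
    using dv[OF that] level_set_measurable[OF mem_measurable[OF vE[OF that]]]
    by (auto simp: V_def distribution_def)
  have I: "{0<..<b} \<in> sets half_line" by (rule half_line_borelI) auto
  have I_emeasure: "emeasure half_line {0<..<b} = ennreal b"
    using b by (subst emeasure_half_line) auto
  have A: "A \<in> sets half_line" unfolding A_def using V I by (intro sets.Un sets.finite_UN) auto
  have "emeasure half_line A \<le> emeasure half_line {0<..<b} + (\<Sum>i<n. emeasure half_line (V i))"
    unfolding A_def using V I
    by (intro order_trans[OF emeasure_subadditive] add_left_mono emeasure_subadditive_finite
        sets.finite_UN) auto
  also have "\<dots> \<le> ennreal b + (\<Sum>i<n. ennreal b)"
    unfolding I_emeasure using V by (intro add_left_mono sum_mono) auto
  also have "\<dots> = (\<Sum>i<n + 1. ennreal b)"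
    by (simp only: Suc_eq_plus1[symmetric] sum.lessThan_Suc) (rule add.commute)
  also have "\<dots> = ennreal (\<Sum>i<n + 1. b)" using b by (intro sum_ennreal) simp
  also have "\<dots> = ennreal (real (n + 1) * b)" by simp
  finally have A_emeasure: "emeasure half_line A \<le> ennreal (real (n + 1) * b)" .
  then have A_fin: "emeasure half_line A < \<infinity>" by (rule le_less_trans) simp
  have A_measure: "measure half_line A \<le> real (n + 1) * b"
    unfolding measure_def using A_emeasure b by (intro enn2real_leI) auto
  have iu: "integrable half_line (\<lambda>t. \<bar>u i t\<bar> * indicator (U i) t)" if "i < n" for i
    unfolding U_def using du[OF that]
    by (intro L1_plus_Linf_abs_integrable_above_level mem_L1_plus_Linf uE that)
       (auto intro: le_less_trans)
  have iv: "integrable half_line (\<lambda>t. \<bar>v i t\<bar> * indicator (V i) t)" if "i < n" for i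
    unfolding V_def using dv[OF that]
    by (intro L1_plus_Linf_abs_integrable_above_level mem_L1_plus_Linf vE that)
       (auto intro: le_less_trans)
  have iA: "integrable half_line (\<lambda>t. \<tau> i * indicator A t)" for i
    using A A_fin by (intro integrable_mult_right integrable_real_indicator) auto
  have ig: "integrable half_line (\<lambda>t. g t * indicator {0<..<b} t)"
    using I I_emeasure by (intro L1_plus_Linf_integrable_on[OF mem_L1_plus_Linf[OF g(1)]]) auto
  have iR: "integrable half_line (\<lambda>t. \<bar>u i t\<bar> * indicator (U i) t - \<bar>v i t\<bar> * indicator (V i) t + \<tau> i * indicator A t)"
    if "i < n" for i
    by (intro Bochner_Integration.integrable_add Bochner_Integration.integrable_diff iu iv iA that)
  have "AE t in half_line. \<forall>i\<in>{..<n}. 0 \<le> u i t \<and> 0 \<le> v i t"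
    using uv by (intro eventually_ball_finite) (auto simp: rearranged_pair_def)
  then have "AE t in half_line. g t * indicator {0<..<b} t \<le>
      (\<Sum>i<n. \<bar>u i t\<bar> * indicator (U i) t - \<bar>v i t\<bar> * indicator (V i) t + \<tau> i * indicator A t)"
    using AE_space
  proof eventually_elim
    case (elim t)
    then have t: "0 < t" and pos: "\<And>i. i < n \<Longrightarrow> 0 \<le> u i t \<and> 0 \<le> v i t" by auto
    show ?case
    proof (cases "t \<in> A")
      case True
      have "g t * indicator {0<..<b} t \<le> g t" using g(2)[OF t] by (simp add: indicator_def)
      also have "\<dots> = (\<Sum>i<n. u i t - v i t)" by (rule g_eq[OF t])
      also have "\<dots> \<le> (\<Sum>i<n. \<bar>u i t\<bar> * indicator (U i) t - \<bar>v i t\<bar> * indicator (V i) t + \<tau> i * indicator A t)"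
      proof (rule sum_mono)
        fix i assume "i \<in> {..<n}"
        then have i: "i < n" by simp
        show "u i t - v i t \<le> \<bar>u i t\<bar> * indicator (U i) t - \<bar>v i t\<bar> * indicator (V i) t + \<tau> i * indicator A t"
          using pos[OF i] \<tau>[OF i] True t by (auto simp: indicator_def U_def V_def)
      qed
      finally show ?thesis .
    next
      case False
      then have "g t * indicator {0<..<b} t = 0" by (auto simp: A_def)
      also have "\<dots> \<le> (\<Sum>i<n. \<bar>u i t\<bar> * indicator (U i) t - \<bar>v i t\<bar> * indicator (V i) t + \<tau> i * indicator A t)"
        using False by (intro sum_nonneg) (auto simp: A_def indicator_def)
      finally show ?thesis .
    qed
  qed
  then have "(\<integral>t. g t * indicator {0<..<b} t \<partial>half_line) \<le>
    (\<integral>t. (\<Sum>i<n. \<bar>u i t\<bar> * indicator (U i) t - \<bar>v i t\<bar> * indicator (V i) t + \<tau> i * indicator A t) \<partial>half_line)"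
    using iR by (intro integral_mono_AE[OF ig] Bochner_Integration.integrable_sum) auto
  also have "\<dots> = (\<Sum>i<n. \<integral>t. \<bar>u i t\<bar> * indicator (U i) t - \<bar>v i t\<bar> * indicator (V i) t + \<tau> i * indicator A t \<partial>half_line)"
    using iR by (intro Bochner_Integration.integral_sum) auto
  also have "\<dots> = (\<Sum>i<n. \<tau> i * measure half_line A)"
  proof (rule sum.cong)
    fix i assume "i \<in> {..<n}"
    then have i: "i < n" by simp
    have "(\<integral>t. \<bar>u i t\<bar> * indicator (U i) t \<partial>half_line) = (\<integral>t. \<bar>v i t\<bar> * indicator (V i) t \<partial>half_line)"
      unfolding U_def V_def using du[OF i]
      by (intro integral_rearranged_above_level uv i \<tau>) (auto intro: le_less_trans)
    moreover have "A \<inter> {0<..} = A" by (auto simp: A_def V_def)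
    ultimately show "(\<integral>t. \<bar>u i t\<bar> * indicator (U i) t - \<bar>v i t\<bar> * indicator (V i) t + \<tau> i * indicator A t \<partial>half_line) =
        \<tau> i * measure half_line A"
      using iu[OF i] iv[OF i] iA[of i] A A_fin
      by (subst Bochner_Integration.integral_add, simp, simp, subst Bochner_Integration.integral_diff) auto
  qed simp
  also have "\<dots> = measure half_line A * (\<Sum>i<n. \<tau> i)"
    unfolding sum_distrib_right[symmetric] by (rule mult.commute)
  also have "\<dots> \<le> (real (n + 1) * b) * (\<Sum>i<n. \<tau> i)"
    using A_measure \<tau> by (intro mult_right_mono sum_nonneg) auto
  finally show ?thesis by (simp add: \<tau>_def)
qed

end

section \<open>Symmetric functionals with a prescribed value\<close>

context symmetric_banach_space
begin

lemma dilation_decr_rearr_mem: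
  assumes x: "x \<in> E" and m: "0 < m"
  shows "dilation (real m) (decr_rearr x) \<in> E"
proof (rule distribution_le_copies(1)[OF decr_rearr_mem(1)[OF x] _ m])
  show "dilation (real m) (decr_rearr x) \<in> borel_measurable half_line"
    using m by (intro dilation_measurable decr_rearr_measurable mem_L1_plus_Linf x) simp
  show "distribution (dilation (real m) (decr_rearr x)) s \<le> of_nat m * distribution (decr_rearr x) s" for s
    using m by (simp add: distribution_dilation ennreal_of_nat_eq_real_of_nat)
qed

lemma dilation_averages_convergent:
  assumes x: "x \<in> E"
  shows "convergent (\<lambda>m::nat. 1 / real m * nrm (dilation (real m) (decr_rearr x)))"
proof (rule subhomogeneous_average_convergent)
  let ?g = "decr_rearr x"
  have xL: "x \<in> L1_plus_Linf" by (rule mem_L1_plus_Linf[OF x])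
  have mem: "dilation (real m) ?g \<in> E" if "0 < m" for m
    by (rule dilation_decr_rearr_mem[OF x that])
  show "0 \<le> nrm (dilation (real m) ?g)" if "0 < m" for m :: nat
    by (rule nrm_nonneg[OF mem[OF that]])
  show "nrm (dilation (real m) ?g) \<le> nrm (dilation (real n) ?g)" if mn: "0 < m" "m \<le> n" for m n :: nat
  proof -
    have n: "0 < n" using mn by simp
    have "0 \<le> dilation (real m) ?g t \<and> dilation (real m) ?g t \<le> dilation (real n) ?g t" if "0 < t" for t
      using mn that unfolding dilation_def
      by (auto intro!: decr_rearr_nonneg[OF xL] decr_rearr_antimono[OF xL] divide_left_mono)
    then have "AE t in half_line. 0 \<le> dilation (real m) ?g t \<and> dilation (real m) ?g t \<le> dilation (real n) ?g t"
      by (intro AE_I2) simp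
    with solid[OF mem[OF n] mem_measurable[OF mem[OF mn(1)]]] show ?thesis by blast
  qed
  show "nrm (dilation (real (k * m)) ?g) \<le> real k * nrm (dilation (real m) ?g)"
    if km: "0 < k" "0 < m" for k m :: nat
  proof (rule distribution_le_copies(2)[OF mem[OF km(2)] _ km(1)])
    show "dilation (real (k * m)) ?g \<in> borel_measurable half_line"
      using km by (intro mem_measurable mem) simp
    show "distribution (dilation (real (k * m)) ?g) s \<le> of_nat k * distribution (dilation (real m) ?g) s" for s
      using km by (simp add: distribution_dilation ennreal_of_nat_eq_real_of_nat ennreal_mult mult.assoc)
  qed
qed

text \<open>With \<open>f\<close> the decreasing majorant from \<open>integral_bound_of_rearrangement_differences\<close>, the
average of order \<open>2\<^sup>N\<close> is at most \<open>16 \<parallel>f\<parallel> / (N + 1)\<close>.  As the whole sequence converges, this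
subsequence determines its limit.\<close>

lemma dilation_averages_tendsto_0:
  assumes x: "x \<in> E"
    and span: "decr_rearr x \<in> module.span (\<lambda>c f t. c * f t) rearrangement_differences"
  shows "(\<lambda>m::nat. 1 / real m * nrm (dilation (real m) (decr_rearr x))) \<longlonglongrightarrow> 0"
proof -
  let ?g = "decr_rearr x"
  have xL: "x \<in> L1_plus_Linf" by (rule mem_L1_plus_Linf[OF x])
  have gE: "?g \<in> E" by (rule decr_rearr_mem(1)[OF x])
  have g_anti: "?g t \<le> ?g s" if "0 < s" "s \<le> t" for s t
    by (rule decr_rearr_antimono[OF xL that])
  have g_nonneg: "0 \<le> ?g t" if "0 < t" for t by (rule decr_rearr_nonneg[OF xL that])
  obtain n :: nat and u v where uv: "\<And>i. i < n \<Longrightarrow> rearranged_pair (u i) (v i)"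
    and g_eq: "\<And>t. ?g t = (\<Sum>i<n. u i t - v i t)"
    using span_rearrangement_differences[OF span] by blast
  have uE: "u i \<in> E" and uL: "u i \<in> L1_plus_Linf" if "i < n" for i
    using uv[OF that] mem_L1_plus_Linf by (auto simp: rearranged_pair_def)
  define f where "f t = real (n + 1) * (\<Sum>i<n. decr_rearr (u i) t)" for t
  have fE: "f \<in> E"
    unfolding f_def[abs_def] using uE by (intro scale_mem sum_mem decr_rearr_mem) auto
  have f_anti: "f t \<le> f s" if "0 < s" "s \<le> t" for s t
    unfolding f_def using that uL by (intro mult_left_mono sum_mono decr_rearr_antimono) auto
  have f_nonneg: "0 \<le> f t" if "0 < t" for t
    unfolding f_def using that uL by (intro mult_nonneg_nonneg sum_nonneg decr_rearr_nonneg) auto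
  have dom: "(\<Sum>k\<le>N. 2 powi (i - int k) * ?g (2 powi (i - int k))) \<le> 4 * 2 powi i * f (2 powi (i + 1))" for N i
  proof -
    let ?b = "2 powi (i + 1) :: real"
    have b: "0 < ?b" by simp
    have "emeasure half_line {0<..<?b} = ennreal ?b"
      by (subst emeasure_half_line) auto
    then have "integrable half_line (\<lambda>t. ?g t * indicator {0<..<?b} t)"
      by (intro L1_plus_Linf_integrable_on mem_L1_plus_Linf gE half_line_borelI) auto
    then have "(\<Sum>k\<le>N. 2 powi (i - int k) * ?g (2 powi (i - int k))) \<le>
        2 * (\<integral>t. ?g t * indicator {0<..<?b} t \<partial>half_line)"
      by (rule sum_le_integral_antimono[OF _ g_anti g_nonneg])
    also have "\<dots> \<le> 2 * (real (n + 1) * ?b * (\<Sum>i<n. decr_rearr (u i) ?b))"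
      using integral_bound_of_rearrangement_differences[OF gE g_nonneg uv g_eq b] by simp
    also have "\<dots> = 4 * 2 powi i * f ?b"
      by (simp add: f_def power_int_add)
    finally show ?thesis .
  qed
  have bound: "1 / real (2 ^ N) * nrm (dilation (real (2 ^ N)) ?g) \<le> 16 * nrm f * inverse (real (Suc N))" for N
    using dilation_bound_of_dyadic_domination[OF fE f_anti f_nonneg decr_rearr_measurable[OF xL] g_anti g_nonneg dom, of N]
    by (simp add: field_simps)
  obtain c where c: "(\<lambda>m::nat. 1 / real m * nrm (dilation (real m) ?g)) \<longlonglongrightarrow> c"
    using dilation_averages_convergent[OF x] unfolding convergent_def by blast
  have "strict_mono (\<lambda>N::nat. 2 ^ N :: nat)"
    by (rule strict_monoI) simp
  from LIMSEQ_subseq_LIMSEQ[OF c this]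
  have sub: "(\<lambda>N. 1 / real (2 ^ N) * nrm (dilation (real (2 ^ N)) ?g)) \<longlonglongrightarrow> c"
    by (simp add: o_def)
  have "(\<lambda>N. 1 / real (2 ^ N) * nrm (dilation (real (2 ^ N)) ?g)) \<longlonglongrightarrow> 0"
  proof (rule tendsto_sandwich)
    show "\<forall>\<^sub>F N in sequentially. 0 \<le> 1 / real (2 ^ N) * nrm (dilation (real (2 ^ N)) ?g)"
      by (intro always_eventually allI mult_nonneg_nonneg nrm_nonneg dilation_decr_rearr_mem x) auto
    show "\<forall>\<^sub>F N in sequentially. 1 / real (2 ^ N) * nrm (dilation (real (2 ^ N)) ?g) \<le>
        16 * nrm f * inverse (real (Suc N))"
      using bound by (intro always_eventually allI)
    show "(\<lambda>N. 16 * nrm f * inverse (real (Suc N))) \<longlonglongrightarrow> 0"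
      using tendsto_mult_left[OF LIMSEQ_inverse_real_of_nat, of "16 * nrm f"] by simp
  qed simp
  with sub have "c = 0" by (rule LIMSEQ_unique)
  with c show ?thesis by simp
qed

text \<open>Positive and negative part of a null function are equimeasurable.  Hence a functional that
vanishes on the differences respects equality almost everywhere.\<close>

lemma AE_zero_mem_rearrangement_differences:
  assumes h: "h \<in> E" and h0: "AE t in half_line. h t = 0"
  shows "h \<in> rearrangement_differences"
proof -
  have *: "w \<in> E \<and> (\<forall>s\<ge>0. distribution w s = 0)"
    if w: "w \<in> borel_measurable half_line" "AE t in half_line. w t = 0" for w
  proof -
    have "w \<in> E"
      using w by (intro abs_le_mem(1)[OF zero_mem]) auto
    moreover have "distribution w s = 0" if "0 \<le> s" for s
    proof -
      have "distribution w s = emeasure half_line {}"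
        unfolding distribution_def
      proof (rule emeasure_eq_AE)
        show "AE u in half_line. u \<in> {u \<in> {0<..}. s < \<bar>w u\<bar>} \<longleftrightarrow> u \<in> {}"
          using w(2) by eventually_elim (use that in auto)
      qed (use level_set_measurable[OF w(1)] in auto)
      then show ?thesis by simp
    qed
    ultimately show ?thesis by blast
  qed
  have hm: "h \<in> borel_measurable half_line" by (rule mem_measurable[OF h])
  have "(\<lambda>t. max (h t) 0) \<in> borel_measurable half_line"
    "(\<lambda>t. max (- h t) 0) \<in> borel_measurable half_line"
    using hm by auto
  moreover have "AE t in half_line. max (h t) 0 = 0" "AE t in half_line. max (- h t) 0 = 0"
    using h0 by (eventually_elim, simp)+
  ultimately have "rearranged_pair (\<lambda>t. max (h t) 0) (\<lambda>t. max (- h t) 0)"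
    using * by (simp add: rearranged_pair_def)
  moreover have "h = (\<lambda>t. max (h t) 0 - max (- h t) 0)" by auto
  ultimately show ?thesis unfolding rearrangement_differences_def by (intro CollectI exI conjI)
qed

lemma symmetric_functional_with_value:
  assumes x: "x \<in> E" and notin: "x \<notin> module.span (\<lambda>c f t. c * f t) rearrangement_differences"
  shows "\<exists>\<phi>. linear_functional_on E \<phi> \<and> symmetric_functional_on E \<phi> \<and> \<phi> x = r"
proof -
  obtain \<phi> where add: "\<And>f g. \<phi> (\<lambda>t. f t + g t) = \<phi> f + \<phi> g"
    and scale: "\<And>c f. \<phi> (\<lambda>t. c * f t) = c * \<phi> f"
    and zero: "\<And>f. f \<in> rearrangement_differences \<Longrightarrow> \<phi> f = 0" and r: "\<phi> x = r"
    using separating_linear_functional[OF notin, of r] by blast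
  have diff: "\<phi> (\<lambda>t. f t - g t) = \<phi> f - \<phi> g" for f g
    using add[of f "\<lambda>t. - 1 * g t"] scale[of "- 1" g] by simp
  have diff_mem: "(\<lambda>t. f t - g t) \<in> E" if "f \<in> E" "g \<in> E" for f g
    using add_mem[OF that(1) scale_mem[OF that(2), of "- 1"]] by simp
  have ae: "\<phi> f = \<phi> g" if fg: "f \<in> E" "g \<in> E" "AE t in half_line. f t = g t" for f g
  proof -
    have "(\<lambda>t. f t - g t) \<in> rearrangement_differences"
      using fg diff_mem by (intro AE_zero_mem_rearrangement_differences) auto
    then show ?thesis using zero diff[of f g] by simp
  qed
  have sym: "\<phi> g = \<phi> f" if fg: "f \<in> E" "g \<in> E" "AE t in half_line. 0 \<le> f t"
    "AE t in half_line. 0 \<le> g t" "equimeasurable g f" for f g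
  proof -
    have "rearranged_pair g f"
      using fg equimeasurable_iff_distribution[of g f] mem_L1_plus_Linf by (auto simp: rearranged_pair_def)
    then have "(\<lambda>t. g t - f t) \<in> rearrangement_differences"
      unfolding rearrangement_differences_def by blast
    then show ?thesis using zero diff[of g f] by simp
  qed
  show ?thesis
    unfolding linear_functional_on_def symmetric_functional_on_def
    using add scale ae sym r by (intro exI[of _ \<phi>]) blast
qed

end

theorem theorem23:
  fixes E :: "(real \<Rightarrow> real) set" and nrm :: "(real \<Rightarrow> real) \<Rightarrow> real" and x :: "real \<Rightarrow> real"
  assumes "symmetric_banach_space E nrm"
    and "x \<in> E" and "AE t in half_line. 0 \<le> x t"
  shows "\<exists>\<phi>. linear_functional_on E \<phi> \<and> symmetric_functional_on E \<phi> \<and>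
    (\<lambda>m::nat. 1 / real m * nrm (dilation (real m) (decr_rearr x))) \<longlonglongrightarrow> \<phi> x"
proof -
  interpret symmetric_banach_space E nrm by fact
  note x = assms(2)
  let ?D = "rearrangement_differences"
  interpret fn: vector_space "\<lambda>c f t. c * f t :: real"
    by unfold_locales (auto simp: fun_eq_iff algebra_simps)
  obtain c where c: "(\<lambda>m::nat. 1 / real m * nrm (dilation (real m) (decr_rearr x))) \<longlonglongrightarrow> c"
    using dilation_averages_convergent[OF x] unfolding convergent_def by blast
  show ?thesis
  proof (cases "c = 0")
    case True
    then show ?thesis using c
      by (intro exI[of _ "\<lambda>_. 0"]) (auto simp: linear_functional_on_def symmetric_functional_on_def)
  next
    case False
    have "x \<notin> fn.span ?D"
    proof
      assume x_span: "x \<in> fn.span ?D"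
      have xL: "x \<in> L1_plus_Linf" by (rule mem_L1_plus_Linf[OF x])
      \<comment> \<open>Modulo the span, \<open>x\<close> may be exchanged for its rearrangement; this uses \<open>x \<ge> 0\<close>.\<close>
      have "rearranged_pair (decr_rearr x) x"
        using decr_rearr_mem(1)[OF x] x assms(3) decr_rearr_nonneg[OF xL] distribution_decr_rearr[OF xL]
        by (auto simp: rearranged_pair_def intro: AE_I2)
      then have "(\<lambda>t. decr_rearr x t - x t) \<in> fn.span ?D"
        unfolding rearrangement_differences_def by (intro fn.span_base) blast
      from fn.span_add[OF this x_span]
      have "decr_rearr x \<in> fn.span ?D" by (simp add: plus_fun_def)
      from LIMSEQ_unique[OF c dilation_averages_tendsto_0[OF x this]] False
      show False by simp
    qed
    from symmetric_functional_with_value[OF x this, of c] c show ?thesis by blast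
  qed
qed

end
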